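(* Let $(\theta,\beta,\gamma):(H,A,C)\to(H',A',C')$ be a morphism of Doi-Hopf data. Then there is a functor $F:{}_A\mathcal{M}(H)^C\to{}_{A'}\mathcal{M}(H')^{C'}$ given by $$F(M)=A'\otimes_AM,$$ where the Doi-Hopf module structure on $A'\otimes_AM$ is $$a'\cdot(b'\otimes m)=\alpha_{A'}(a')b'\otimes\alpha_M(m),\qquad \rho(b'\otimes m)=b'_{(0)}\otimes m_{(0)}\otimes\alpha_{C'}^{-2}(b'_{(1)}\cdot\gamma(m_{(1)})),$$ for all $a',b'\in A'$ and $m\in M$.
   Context: Work over a field $k$, $\otimes=\otimes_k$. All structure maps $\alpha$ below are assumed bijective. Hom-algebra $(A,\alpha_A)$: a linear multiplication, a unit $1_A$ and a linear $\alpha_A:A\to A$ with $\alpha_A(ab)=\alpha_A(a)\alpha_A(b)$, $\alpha_A(1_A)=1_A$, $1_Aa=\alpha_A(a)=a1_A$, $\alpha_A(a)(bc)=(ab)\alpha_A(c)$. Hom-coalgebra $(C,\alpha_C)$: linear $\Delta:C\to C\otimes C$, $\Delta(c)=c_1\otimes c_2$, $\varepsilon:C\to k$ and $\alpha_C$ with $\varepsilon\circ\alpha_C=\varepsilon$, $(\alpha_C\otimes\alpha_C)\Delta=\Delta\alpha_C$, $(\varepsilon\otimes id)\Delta=\alpha_C=(id\otimes\varepsilon)\Delta$, $(\Delta\otimes\alpha_C)\Delta=(\alpha_C\otimes\Delta)\Delta$. Morphisms preserve all structure and commute with the $\alpha$'s. Hom-bialgebra: a Hom-algebra and Hom-coalgebra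 with the same $\alpha$ such that $\Delta,\varepsilon$ are Hom-algebra morphisms. Hom-Hopf algebra: a Hom-bialgebra with a linear $S$, $S\alpha=\alpha S$, $S(h_1)h_2=h_1S(h_2)=\varepsilon(h)1$. Left $A$-module $(M,\alpha_M)$: linear $A\otimes M\to M$ with $1_A\cdot m=\alpha_M(m)$, $\alpha_M(a\cdot m)=\alpha_A(a)\cdot\alpha_M(m)$, $\alpha_A(a)\cdot(b\cdot m)=(ab)\cdot\alpha_M(m)$; right modules similarly. Right $C$-comodule $(M,\alpha_M)$: linear $\rho:M\to M\otimes C$, $\rho(m)=m_{(0)}\otimes m_{(1)}$, with $(id\otimes\varepsilon)\rho=\alpha_M$, $(\alpha_M\otimes\alpha_C)\rho=\rho\alpha_M$, $(\rho\otimes\alpha_C)\rho=(\alpha_M\otimes\Delta)\rho$. (Co)module maps are (co)linear and commute with the $\alpha$'s. A (Hom-type) Doi-Hopf datum $(H,A,C)$ consists of a Hom-Hopf algebra $(H,\alpha_H)$, a right $H$-comodule algebra $(A,\alpha_A)$ (a Hom-algebra and right $H$-comodule, $\rho(a)=a_{(0)}\otimes a_{(1)}$, with $\rho(ab)=\rho(a)\rho(b)$, $\rho(1_A)=1_A\otimes1_H$) and a left $H$-module coalgebra $(C,\alpha_C)$ (a Hom-coalgebra and left $H$-module with $\Delta_C(h\cdot c)=h_1\cdot c_1\otimes h_2\cdot c_2$, $\varepsilon_C(h\cdot c)=\varepsilon_H(h)\varepsilon_C(c)$). A Doi-Hopf module over $(H,A,C)$ is $(M,\alpha_M)$ that is a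 left $A$-module and a right $C$-comodule with $\rho(a\cdot m)=a_{(0)}\cdot m_{(0)}\otimes a_{(1)}\cdot m_{(1)}$. ${}_A\mathcal{M}(H)^C$ is the category of these, with $A$-linear $C$-colinear maps. A morphism $(\theta,\beta,\gamma):(H,A,C)\to(H',A',C')$ of Doi-Hopf data consists of a Hom-Hopf algebra map $\theta:H\to H'$, a Hom-algebra map $\beta:A\to A'$ and a Hom-coalgebra map $\gamma:C\to C'$ with $\gamma(h\cdot c)=\theta(h)\cdot\gamma(c)$ and $\rho(\beta(a))=\beta(a_{(0)})\otimes\theta(a_{(1)})$. For a right $A$-module $(P,\mu)$ and a left $A$-module $(N,\nu)$, $P\otimes_AN$ is the quotient of $P\otimes N$ by the span of all $p\cdot a\otimes\nu(n)-\mu(p)\otimes a\cdot n$. Here $A'$ is a right $A$-module via $b'\cdot a=b'\beta(a)$; the structure map of $A'\otimes_AM$ is $\alpha_{A'}\otimes\alpha_M$, and $F(f)=id\otimes f$ on morphisms. *)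

theory Defs
  imports "HOL-Algebra.Module" "HOL-Algebra.AbelCoset"
begin

section \<open>Linear maps, quotients and tensor products\<close>

text \<open>
  Vector spaces are modules over a field in the sense of HOL-Algebra. As there, the fields
  \<open>mult\<close> and \<open>one\<close> of the record are meaningless for a mere module.
\<close>

definition linear_maps ::
    "('k, 'r) ring_scheme \<Rightarrow> ('k, 'v, 's) module_scheme \<Rightarrow> ('k, 'w, 't) module_scheme \<Rightarrow> ('v \<Rightarrow> 'w) set"
  where "linear_maps K V W =
    {f \<in> carrier V \<rightarrow> carrier W.
      (\<forall>x\<in>carrier V. \<forall>y\<in>carrier V. f (x \<oplus>\<^bsub>V\<^esub> y) = f x \<oplus>\<^bsub>W\<^esub> f y) \<and>
      (\<forall>a\<in>carrier K. \<forall>x\<in>carrier V. f (a \<odot>\<^bsub>V\<^esub> x) = a \<odot>\<^bsub>W\<^esub> f x)}"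

definition bilinear_maps ::
    "('k, 'r) ring_scheme \<Rightarrow> ('k, 'v, 's) module_scheme \<Rightarrow> ('k, 'w, 't) module_scheme \<Rightarrow>
     ('k, 'u, 'q) module_scheme \<Rightarrow> ('v \<Rightarrow> 'w \<Rightarrow> 'u) set"
  where "bilinear_maps K V W U =
    {b. (\<forall>v\<in>carrier V. b v \<in> linear_maps K W U) \<and>
        (\<forall>w\<in>carrier W. (\<lambda>v. b v w) \<in> linear_maps K V U)}"

definition submodule_span ::
    "('k, 'r) ring_scheme \<Rightarrow> ('k, 'v, 's) module_scheme \<Rightarrow> 'v set \<Rightarrow> 'v set"
  where "submodule_span K V S = \<Inter>{U. submodule U K V \<and> S \<subseteq> U}"

definition quotient_module :: "('k, 'v, 's) module_scheme \<Rightarrow> 'v set \<Rightarrow> ('k, 'v set) module"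
  where "quotient_module V U =
    \<lparr>carrier = a_rcosets\<^bsub>V\<^esub> U, mult = undefined, one = undefined, zero = U, add = set_add V,
     smult = (\<lambda>a X. \<Union>x\<in>X. U +>\<^bsub>V\<^esub> (a \<odot>\<^bsub>V\<^esub> x))\<rparr>"

definition free_module :: "('k, 'r) ring_scheme \<Rightarrow> 'x set \<Rightarrow> ('k, 'x \<Rightarrow> 'k) module"
  where "free_module K X =
    \<lparr>carrier = {f. (\<forall>x. f x \<in> carrier K) \<and> (\<forall>x. x \<notin> X \<longrightarrow> f x = \<zero>\<^bsub>K\<^esub>) \<and> finite {x. f x \<noteq> \<zero>\<^bsub>K\<^esub>}},
     mult = undefined, one = undefined, zero = (\<lambda>x. \<zero>\<^bsub>K\<^esub>),
     add = (\<lambda>f g x. f x \<oplus>\<^bsub>K\<^esub> g x), smult = (\<lambda>a f x. a \<otimes>\<^bsub>K\<^esub> f x)\<rparr>"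

definition free_gen :: "('k, 'r) ring_scheme \<Rightarrow> 'x \<Rightarrow> 'x \<Rightarrow> 'k"
  where "free_gen K x = (\<lambda>y. if y = x then \<one>\<^bsub>K\<^esub> else \<zero>\<^bsub>K\<^esub>)"

type_synonym ('k, 'v, 'w) tensor = "('v \<times> 'w \<Rightarrow> 'k) set"

definition tensor_relations ::
    "('k, 'r) ring_scheme \<Rightarrow> ('k, 'v, 's) module_scheme \<Rightarrow> ('k, 'w, 't) module_scheme \<Rightarrow>
     ('v \<times> 'w \<Rightarrow> 'k) set"
  where "tensor_relations K V W = (let F = free_module K (carrier V \<times> carrier W); e = free_gen K in
    {e (v \<oplus>\<^bsub>V\<^esub> v', w) \<ominus>\<^bsub>F\<^esub> (e (v, w) \<oplus>\<^bsub>F\<^esub> e (v', w)) | v v' w.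
        v \<in> carrier V \<and> v' \<in> carrier V \<and> w \<in> carrier W} \<union>
    {e (v, w \<oplus>\<^bsub>W\<^esub> w') \<ominus>\<^bsub>F\<^esub> (e (v, w) \<oplus>\<^bsub>F\<^esub> e (v, w')) | v w w'.
        v \<in> carrier V \<and> w \<in> carrier W \<and> w' \<in> carrier W} \<union>
    {e (a \<odot>\<^bsub>V\<^esub> v, w) \<ominus>\<^bsub>F\<^esub> (a \<odot>\<^bsub>F\<^esub> e (v, w)) | a v w.
        a \<in> carrier K \<and> v \<in> carrier V \<and> w \<in> carrier W} \<union>
    {e (v, a \<odot>\<^bsub>W\<^esub> w) \<ominus>\<^bsub>F\<^esub> (a \<odot>\<^bsub>F\<^esub> e (v, w)) | a v w.
        a \<in> carrier K \<and> v \<in> carrier V \<and> w \<in> carrier W})"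

definition tensor_null ::
    "('k, 'r) ring_scheme \<Rightarrow> ('k, 'v, 's) module_scheme \<Rightarrow> ('k, 'w, 't) module_scheme \<Rightarrow>
     ('v \<times> 'w \<Rightarrow> 'k) set"
  where "tensor_null K V W =
    submodule_span K (free_module K (carrier V \<times> carrier W)) (tensor_relations K V W)"

definition tensor_space ::
    "('k, 'r) ring_scheme \<Rightarrow> ('k, 'v, 's) module_scheme \<Rightarrow> ('k, 'w, 't) module_scheme \<Rightarrow>
     ('k, ('k, 'v, 'w) tensor) module"
  where "tensor_space K V W =
    quotient_module (free_module K (carrier V \<times> carrier W)) (tensor_null K V W)"

definition tens ::
    "('k, 'r) ring_scheme \<Rightarrow> ('k, 'v, 's) module_scheme \<Rightarrow> ('k, 'w, 't) module_scheme \<Rightarrow>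
     'v \<Rightarrow> 'w \<Rightarrow> ('k, 'v, 'w) tensor"
  where "tens K V W v w =
    tensor_null K V W +>\<^bsub>free_module K (carrier V \<times> carrier W)\<^esub> free_gen K (v, w)"

text \<open>
  The linear map on the tensor product induced by a bilinear map \<open>b\<close>. It also renders Sweedler
  notation: if \<open>x = v\<^sub>1 \<otimes> v\<^sub>2\<close> (a suppressed sum), then \<open>tensor_lift K V W T b x\<close> is \<open>b v\<^sub>1 v\<^sub>2\<close>.
\<close>

definition tensor_lift ::
    "('k, 'r) ring_scheme \<Rightarrow> ('k, 'v, 's) module_scheme \<Rightarrow> ('k, 'w, 't) module_scheme \<Rightarrow>
     ('k, 'u, 'q) module_scheme \<Rightarrow> ('v \<Rightarrow> 'w \<Rightarrow> 'u) \<Rightarrow> ('k, 'v, 'w) tensor \<Rightarrow> 'u"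
  where "tensor_lift K V W T b =
    (THE f. f \<in> linear_maps K (tensor_space K V W) T \<inter> extensional (carrier (tensor_space K V W)) \<and>
      (\<forall>v\<in>carrier V. \<forall>w\<in>carrier W. f (tens K V W v w) = b v w))"

definition tensor_map ::
    "('k, 'r) ring_scheme \<Rightarrow> ('k, 'v, 's) module_scheme \<Rightarrow> ('k, 'w, 't) module_scheme \<Rightarrow>
     ('k, 'x, 'p) module_scheme \<Rightarrow> ('k, 'y, 'q) module_scheme \<Rightarrow>
     ('v \<Rightarrow> 'x) \<Rightarrow> ('w \<Rightarrow> 'y) \<Rightarrow> ('k, 'v, 'w) tensor \<Rightarrow> ('k, 'x, 'y) tensor"
  where "tensor_map K V W X Y f g =
    tensor_lift K V W (tensor_space K X Y) (\<lambda>v w. tens K X Y (f v) (g w))"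

text \<open>\<open>(v \<otimes> w, v' \<otimes> w') \<mapsto> f v v' \<otimes> g w w'\<close> for bilinear \<open>f : V \<times> V' \<rightarrow> X\<close> and \<open>g : W \<times> W' \<rightarrow> Y\<close>\<close>

definition tensor_bimap ::
    "('k, 'r) ring_scheme \<Rightarrow> ('k, 'v, 's) module_scheme \<Rightarrow> ('k, 'w, 't) module_scheme \<Rightarrow>
     ('k, 'v', 's') module_scheme \<Rightarrow> ('k, 'w', 't') module_scheme \<Rightarrow>
     ('k, 'x, 'p) module_scheme \<Rightarrow> ('k, 'y, 'q) module_scheme \<Rightarrow>
     ('v \<Rightarrow> 'v' \<Rightarrow> 'x) \<Rightarrow> ('w \<Rightarrow> 'w' \<Rightarrow> 'y) \<Rightarrow>
     ('k, 'v, 'w) tensor \<Rightarrow> ('k, 'v', 'w') tensor \<Rightarrow> ('k, 'x, 'y) tensor"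
  where "tensor_bimap K V W V' W' X Y f g s t =
    tensor_lift K V W (tensor_space K X Y)
      (\<lambda>v w. tensor_map K V' W' X Y (f v) (g w) t) s"

definition tensor_assoc ::
    "('k, 'r) ring_scheme \<Rightarrow> ('k, 'u, 'q) module_scheme \<Rightarrow> ('k, 'v, 's) module_scheme \<Rightarrow>
     ('k, 'w, 't) module_scheme \<Rightarrow>
     ('k, ('k, 'u, 'v) tensor, 'w) tensor \<Rightarrow> ('k, 'u, ('k, 'v, 'w) tensor) tensor"
  where "tensor_assoc K U V W =
    (let T = tensor_space K U (tensor_space K V W) in
      tensor_lift K (tensor_space K U V) W T
        (\<lambda>s w. tensor_lift K U V T
          (\<lambda>u v. tens K U (tensor_space K V W) u (tens K V W v w)) s))"


section \<open>Hom-algebras and Hom-coalgebras\<close>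

record ('k, 'v) hom_module = "('k, 'v) module" +
  twist :: "'v \<Rightarrow> 'v"

record ('k, 'v) hom_coalgebra = "('k, 'v) hom_module" +
  comult :: "'v \<Rightarrow> ('k, 'v, 'v) tensor"
  counit :: "'v \<Rightarrow> 'k"

record ('k, 'v) hom_hopf_algebra = "('k, 'v) hom_coalgebra" +
  antipode :: "'v \<Rightarrow> 'v"

locale hom_module = field K + module K V for K (structure) and V (structure) +
  assumes twist_linear: "twist V \<in> linear_maps K V V"
    and twist_bij: "bij_betw (twist V) (carrier V) (carrier V)"

text \<open>
  The multiplication and unit of a Hom-algebra are the fields \<open>mult\<close> and \<open>one\<close> of the record; linear
  maps out of \<open>A \<otimes> A\<close> (and, for actions, out of \<open>A \<otimes> M\<close>) are given as bilinear maps.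
\<close>

locale hom_algebra = hom_module K A for K (structure) and A (structure) +
  assumes mult_bilinear: "mult A \<in> bilinear_maps K A A A"
    and one_closed: "\<one>\<^bsub>A\<^esub> \<in> carrier A"
    and twist_mult: "\<lbrakk>a \<in> carrier A; b \<in> carrier A\<rbrakk> \<Longrightarrow> twist A (a \<otimes>\<^bsub>A\<^esub> b) = twist A a \<otimes>\<^bsub>A\<^esub> twist A b"
    and twist_one: "twist A \<one>\<^bsub>A\<^esub> = \<one>\<^bsub>A\<^esub>"
    and hom_l_one: "a \<in> carrier A \<Longrightarrow> \<one>\<^bsub>A\<^esub> \<otimes>\<^bsub>A\<^esub> a = twist A a"
    and hom_r_one: "a \<in> carrier A \<Longrightarrow> a \<otimes>\<^bsub>A\<^esub> \<one>\<^bsub>A\<^esub> = twist A a"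
    and hom_assoc: "\<lbrakk>a \<in> carrier A; b \<in> carrier A; c \<in> carrier A\<rbrakk> \<Longrightarrow>
      twist A a \<otimes>\<^bsub>A\<^esub> (b \<otimes>\<^bsub>A\<^esub> c) = (a \<otimes>\<^bsub>A\<^esub> b) \<otimes>\<^bsub>A\<^esub> twist A c"

definition ground_hom_algebra :: "('k, 'r) ring_scheme \<Rightarrow> ('k, 'k) hom_module"
  where "ground_hom_algebra K =
    \<lparr>carrier = carrier K, mult = mult K, one = \<one>\<^bsub>K\<^esub>, zero = \<zero>\<^bsub>K\<^esub>, add = add K, smult = mult K,
     twist = (\<lambda>x. x)\<rparr>"

locale hom_coalgebra = hom_module K C for K (structure) and C (structure) +
  assumes comult_linear: "comult C \<in> linear_maps K C (tensor_space K C C)"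
    and counit_linear: "counit C \<in> linear_maps K C (ground_hom_algebra K)"
    and counit_twist: "c \<in> carrier C \<Longrightarrow> counit C (twist C c) = counit C c"
    and comult_twist: "c \<in> carrier C \<Longrightarrow>
      tensor_map K C C C C (twist C) (twist C) (comult C c) = comult C (twist C c)"
    and l_counit: "c \<in> carrier C \<Longrightarrow>
      tensor_lift K C C C (\<lambda>x y. counit C x \<odot>\<^bsub>C\<^esub> y) (comult C c) = twist C c"
    and r_counit: "c \<in> carrier C \<Longrightarrow>
      tensor_lift K C C C (\<lambda>x y. counit C y \<odot>\<^bsub>C\<^esub> x) (comult C c) = twist C c"
    and coassoc: "c \<in> carrier C \<Longrightarrow>
      tensor_assoc K C C C
        (tensor_map K C C (tensor_space K C C) C (comult C) (twist C) (comult C c)) =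
      tensor_map K C C C (tensor_space K C C) (twist C) (comult C) (comult C c)"

definition hom_algebra_map ::
    "('k, 'r) ring_scheme \<Rightarrow> ('k, 'a, 's) hom_module_scheme \<Rightarrow> ('k, 'b, 't) hom_module_scheme \<Rightarrow>
     ('a \<Rightarrow> 'b) \<Rightarrow> bool"
  where "hom_algebra_map K A B f \<longleftrightarrow>
    f \<in> linear_maps K A B \<and>
    (\<forall>x\<in>carrier A. \<forall>y\<in>carrier A. f (x \<otimes>\<^bsub>A\<^esub> y) = f x \<otimes>\<^bsub>B\<^esub> f y) \<and>
    f \<one>\<^bsub>A\<^esub> = \<one>\<^bsub>B\<^esub> \<and>
    (\<forall>x\<in>carrier A. f (twist A x) = twist B (f x))"

definition hom_coalgebra_map ::
    "('k, 'r) ring_scheme \<Rightarrow> ('k, 'c, 's) hom_coalgebra_scheme \<Rightarrow>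
     ('k, 'd, 't) hom_coalgebra_scheme \<Rightarrow> ('c \<Rightarrow> 'd) \<Rightarrow> bool"
  where "hom_coalgebra_map K C D f \<longleftrightarrow>
    f \<in> linear_maps K C D \<and>
    (\<forall>c\<in>carrier C. comult D (f c) = tensor_map K C C D D f f (comult C c)) \<and>
    (\<forall>c\<in>carrier C. counit D (f c) = counit C c) \<and>
    (\<forall>c\<in>carrier C. f (twist C c) = twist D (f c))"

definition tensor_hom_algebra ::
    "('k, 'r) ring_scheme \<Rightarrow> ('k, 'a, 's) hom_module_scheme \<Rightarrow> ('k, 'b, 't) hom_module_scheme \<Rightarrow>
     ('k, ('k, 'a, 'b) tensor) hom_module"
  where "tensor_hom_algebra K A B = (let T = tensor_space K A B in
    \<lparr>carrier = carrier T, mult = tensor_bimap K A B A B A B (mult A) (mult B),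
     one = tens K A B \<one>\<^bsub>A\<^esub> \<one>\<^bsub>B\<^esub>, zero = \<zero>\<^bsub>T\<^esub>, add = add T, smult = smult T,
     twist = tensor_map K A B A B (twist A) (twist B)\<rparr>)"

locale hom_bialgebra = hom_algebra K H + hom_coalgebra K H for K (structure) and H (structure) +
  assumes comult_algebra_map: "hom_algebra_map K H (tensor_hom_algebra K H H) (comult H)"
    and counit_algebra_map: "hom_algebra_map K H (ground_hom_algebra K) (counit H)"

locale hom_hopf_algebra = hom_bialgebra K H for K (structure) and H (structure) +
  assumes antipode_linear: "antipode H \<in> linear_maps K H H"
    and antipode_twist: "h \<in> carrier H \<Longrightarrow> antipode H (twist H h) = twist H (antipode H h)"
    and l_antipode: "h \<in> carrier H \<Longrightarrow>
      tensor_lift K H H H (\<lambda>x y. antipode H x \<otimes>\<^bsub>H\<^esub> y) (comult H h) = counit H h \<odot>\<^bsub>H\<^esub> \<one>\<^bsub>H\<^esub>"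
    and r_antipode: "h \<in> carrier H \<Longrightarrow>
      tensor_lift K H H H (\<lambda>x y. x \<otimes>\<^bsub>H\<^esub> antipode H y) (comult H h) = counit H h \<odot>\<^bsub>H\<^esub> \<one>\<^bsub>H\<^esub>"

definition hom_hopf_algebra_map ::
    "('k, 'r) ring_scheme \<Rightarrow> ('k, 'h, 's) hom_hopf_algebra_scheme \<Rightarrow>
     ('k, 'g, 't) hom_hopf_algebra_scheme \<Rightarrow> ('h \<Rightarrow> 'g) \<Rightarrow> bool"
  where "hom_hopf_algebra_map K H G f \<longleftrightarrow>
    hom_algebra_map K H G f \<and> hom_coalgebra_map K H G f \<and>
    (\<forall>h\<in>carrier H. f (antipode H h) = antipode G (f h))"


section \<open>Modules, comodules and Doi-Hopf data\<close>

locale left_hom_module = A: hom_algebra K A + M: hom_module K M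
  for K (structure) and A (structure) and M (structure) and act :: "'a \<Rightarrow> 'm \<Rightarrow> 'm" +
  assumes act_bilinear: "act \<in> bilinear_maps K A M M"
    and one_act: "m \<in> carrier M \<Longrightarrow> act \<one>\<^bsub>A\<^esub> m = twist M m"
    and twist_act: "\<lbrakk>a \<in> carrier A; m \<in> carrier M\<rbrakk> \<Longrightarrow> twist M (act a m) = act (twist A a) (twist M m)"
    and act_act: "\<lbrakk>a \<in> carrier A; b \<in> carrier A; m \<in> carrier M\<rbrakk> \<Longrightarrow>
      act (twist A a) (act b m) = act (a \<otimes>\<^bsub>A\<^esub> b) (twist M m)"

locale right_hom_comodule = C: hom_coalgebra K C + M: hom_module K M
  for K (structure) and C (structure) and M (structure) and coact :: "'m \<Rightarrow> ('k, 'm, 'c) tensor" +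
  assumes coact_linear: "coact \<in> linear_maps K M (tensor_space K M C)"
    and counit_coact: "m \<in> carrier M \<Longrightarrow>
      tensor_lift K M C M (\<lambda>x c. counit C c \<odot>\<^bsub>M\<^esub> x) (coact m) = twist M m"
    and twist_coact: "m \<in> carrier M \<Longrightarrow>
      tensor_map K M C M C (twist M) (twist C) (coact m) = coact (twist M m)"
    and coact_coact: "m \<in> carrier M \<Longrightarrow>
      tensor_assoc K M C C
        (tensor_map K M C (tensor_space K M C) C coact (twist C) (coact m)) =
      tensor_map K M C M (tensor_space K C C) (twist M) (comult C) (coact m)"

record ('k, 'a, 'h) comodule_algebra = "('k, 'a) hom_module" +
  alg_coact :: "'a \<Rightarrow> ('k, 'a, 'h) tensor"

record ('k, 'c, 'h) module_coalgebra = "('k, 'c) hom_coalgebra" +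
  coalg_act :: "'h \<Rightarrow> 'c \<Rightarrow> 'c"

record ('k, 'm, 'a, 'c) doi_hopf_module = "('k, 'm) hom_module" +
  act :: "'a \<Rightarrow> 'm \<Rightarrow> 'm"
  coact :: "'m \<Rightarrow> ('k, 'm, 'c) tensor"

locale comodule_algebra =
  hom_algebra K A + right_hom_comodule K H A "alg_coact A"
  for K (structure) and H (structure) and A (structure) +
  assumes alg_coact_mult: "\<lbrakk>a \<in> carrier A; b \<in> carrier A\<rbrakk> \<Longrightarrow>
      alg_coact A (a \<otimes>\<^bsub>A\<^esub> b) = alg_coact A a \<otimes>\<^bsub>tensor_hom_algebra K A H\<^esub> alg_coact A b"
    and alg_coact_one: "alg_coact A \<one>\<^bsub>A\<^esub> = tens K A H \<one>\<^bsub>A\<^esub> \<one>\<^bsub>H\<^esub>"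

locale module_coalgebra =
  hom_coalgebra K C + left_hom_module K H C "coalg_act C"
  for K (structure) and H (structure) and C (structure) +
  assumes comult_coalg_act: "\<lbrakk>h \<in> carrier H; c \<in> carrier C\<rbrakk> \<Longrightarrow>
      comult C (coalg_act C h c) =
      tensor_bimap K H H C C C C (coalg_act C) (coalg_act C) (comult H h) (comult C c)"
    and counit_coalg_act: "\<lbrakk>h \<in> carrier H; c \<in> carrier C\<rbrakk> \<Longrightarrow>
      counit C (coalg_act C h c) = counit H h \<otimes>\<^bsub>K\<^esub> counit C c"

locale doi_hopf_datum =
  H: hom_hopf_algebra K H + A: comodule_algebra K H A + C: module_coalgebra K H C
  for K (structure) and H (structure) and A (structure) and C (structure)

locale doi_hopf_module =
  D: doi_hopf_datum K H A C + L: left_hom_module K A M "act M" + R: right_hom_comodule K C M "coact M"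
  for K (structure) and H (structure) and A (structure) and C (structure) and M (structure) +
  assumes coact_act: "\<lbrakk>a \<in> carrier A; m \<in> carrier M\<rbrakk> \<Longrightarrow>
      coact M (act M a m) =
      tensor_bimap K A H M C M C (act M) (coalg_act C) (alg_coact A a) (coact M m)"

locale doi_hopf_datum_morphism =
  S: doi_hopf_datum K H A C + T: doi_hopf_datum K H' A' C'
  for K (structure) and H (structure) and A (structure) and C (structure)
    and H' (structure) and A' (structure) and C' (structure)
    and \<theta> :: "'h \<Rightarrow> 'h'" and \<beta> :: "'a \<Rightarrow> 'a'" and \<gamma> :: "'c \<Rightarrow> 'c'" +
  assumes hopf_map: "hom_hopf_algebra_map K H H' \<theta>"
    and algebra_map: "hom_algebra_map K A A' \<beta>"
    and coalgebra_map: "hom_coalgebra_map K C C' \<gamma>"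
    and coalg_act_map: "\<lbrakk>h \<in> carrier H; c \<in> carrier C\<rbrakk> \<Longrightarrow>
      \<gamma> (coalg_act C h c) = coalg_act C' (\<theta> h) (\<gamma> c)"
    and alg_coact_map: "a \<in> carrier A \<Longrightarrow>
      alg_coact A' (\<beta> a) = tensor_map K A H A' H' \<beta> \<theta> (alg_coact A a)"


section \<open>Categories and functors\<close>

text \<open>
  Hom-sets of different pairs of objects may overlap, so composition and the action of a functor on
  morphisms take the objects as arguments: \<open>Comp \<C> M N P g f\<close> is \<open>g \<circ> f\<close> for \<open>f : M \<rightarrow> N\<close> and
  \<open>g : N \<rightarrow> P\<close>.
\<close>

record ('o, 'f) category =
  Ob :: "'o set"
  Hom :: "'o \<Rightarrow> 'o \<Rightarrow> 'f set"
  Id :: "'o \<Rightarrow> 'f"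
  Comp :: "'o \<Rightarrow> 'o \<Rightarrow> 'o \<Rightarrow> 'f \<Rightarrow> 'f \<Rightarrow> 'f"

locale category =
  fixes \<C> :: "('o, 'f) category"
  assumes Id_closed: "M \<in> Ob \<C> \<Longrightarrow> Id \<C> M \<in> Hom \<C> M M"
    and Comp_closed: "\<lbrakk>M \<in> Ob \<C>; N \<in> Ob \<C>; P \<in> Ob \<C>; f \<in> Hom \<C> M N; g \<in> Hom \<C> N P\<rbrakk> \<Longrightarrow>
      Comp \<C> M N P g f \<in> Hom \<C> M P"
    and Id_Comp: "\<lbrakk>M \<in> Ob \<C>; N \<in> Ob \<C>; f \<in> Hom \<C> M N\<rbrakk> \<Longrightarrow> Comp \<C> M N N (Id \<C> N) f = f"
    and Comp_Id: "\<lbrakk>M \<in> Ob \<C>; N \<in> Ob \<C>; f \<in> Hom \<C> M N\<rbrakk> \<Longrightarrow> Comp \<C> M M N f (Id \<C> M) = f"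
    and Comp_assoc: "\<lbrakk>M \<in> Ob \<C>; N \<in> Ob \<C>; P \<in> Ob \<C>; Q \<in> Ob \<C>;
        f \<in> Hom \<C> M N; g \<in> Hom \<C> N P; h \<in> Hom \<C> P Q\<rbrakk> \<Longrightarrow>
      Comp \<C> M P Q h (Comp \<C> M N P g f) = Comp \<C> M N Q (Comp \<C> N P Q h g) f"

locale cat_functor = S: category \<C> + T: category \<D>
  for \<C> :: "('o, 'f) category" and \<D> :: "('p, 'g) category"
    and Fo :: "'o \<Rightarrow> 'p" and Fm :: "'o \<Rightarrow> 'o \<Rightarrow> 'f \<Rightarrow> 'g" +
  assumes Fo_closed: "M \<in> Ob \<C> \<Longrightarrow> Fo M \<in> Ob \<D>"
    and Fm_closed: "\<lbrakk>M \<in> Ob \<C>; N \<in> Ob \<C>; f \<in> Hom \<C> M N\<rbrakk> \<Longrightarrow> Fm M N f \<in> Hom \<D> (Fo M) (Fo N)"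
    and Fm_Id: "M \<in> Ob \<C> \<Longrightarrow> Fm M M (Id \<C> M) = Id \<D> (Fo M)"
    and Fm_Comp: "\<lbrakk>M \<in> Ob \<C>; N \<in> Ob \<C>; P \<in> Ob \<C>; f \<in> Hom \<C> M N; g \<in> Hom \<C> N P\<rbrakk> \<Longrightarrow>
      Fm M P (Comp \<C> M N P g f) = Comp \<D> (Fo M) (Fo N) (Fo P) (Fm N P g) (Fm M N f)"

text \<open>
  Morphisms are made extensional, so that equality of morphisms is equality of functions.
\<close>

definition doi_hopf_maps ::
    "('k, 'r) ring_scheme \<Rightarrow> ('k, 'a, 'h, 's) comodule_algebra_scheme \<Rightarrow>
     ('k, 'c, 'h, 't) module_coalgebra_scheme \<Rightarrow>
     ('k, 'm, 'a, 'c) doi_hopf_module \<Rightarrow> ('k, 'n, 'a, 'c) doi_hopf_module \<Rightarrow> ('m \<Rightarrow> 'n) set"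
  where "doi_hopf_maps K A C M N =
    {f \<in> linear_maps K M N \<inter> extensional (carrier M).
      (\<forall>m\<in>carrier M. f (twist M m) = twist N (f m)) \<and>
      (\<forall>a\<in>carrier A. \<forall>m\<in>carrier M. f (act M a m) = act N a (f m)) \<and>
      (\<forall>m\<in>carrier M. coact N (f m) = tensor_map K M C N C f (\<lambda>c. c) (coact M m))}"

definition doi_hopf_category ::
    "('k, 'r) ring_scheme \<Rightarrow> ('k, 'h, 'q) hom_hopf_algebra_scheme \<Rightarrow>
     ('k, 'a, 'h, 's) comodule_algebra_scheme \<Rightarrow> ('k, 'c, 'h, 't) module_coalgebra_scheme \<Rightarrow>
     (('k, 'm, 'a, 'c) doi_hopf_module, 'm \<Rightarrow> 'm) category"
  where "doi_hopf_category K H A C =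
    \<lparr>Ob = {M. doi_hopf_module K H A C M},
     Hom = doi_hopf_maps K A C,
     Id = (\<lambda>M. \<lambda>m\<in>carrier M. m),
     Comp = (\<lambda>M N P g f. compose (carrier M) g f)\<rparr>"


section \<open>Induction along a morphism of Doi-Hopf data\<close>

text \<open>
  \<open>P \<otimes>\<^sub>A N\<close>, where \<open>r\<close> is the right action of \<open>A\<close> on \<open>P\<close> and \<open>l\<close> the left action of \<open>A\<close> on \<open>N\<close>.
\<close>

definition balanced_null ::
    "('k, 'r) ring_scheme \<Rightarrow> ('k, 'p, 's) hom_module_scheme \<Rightarrow> ('p \<Rightarrow> 'a \<Rightarrow> 'p) \<Rightarrow>
     ('k, 'a, 't) hom_module_scheme \<Rightarrow> ('k, 'n, 'q) hom_module_scheme \<Rightarrow> ('a \<Rightarrow> 'n \<Rightarrow> 'n) \<Rightarrow>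
     ('k, 'p, 'n) tensor set"
  where "balanced_null K P r A N l = submodule_span K (tensor_space K P N)
    {tens K P N (r p a) (twist N n) \<ominus>\<^bsub>tensor_space K P N\<^esub> tens K P N (twist P p) (l a n) | p a n.
      p \<in> carrier P \<and> a \<in> carrier A \<and> n \<in> carrier N}"

definition balanced_tensor_space ::
    "('k, 'r) ring_scheme \<Rightarrow> ('k, 'p, 's) hom_module_scheme \<Rightarrow> ('p \<Rightarrow> 'a \<Rightarrow> 'p) \<Rightarrow>
     ('k, 'a, 't) hom_module_scheme \<Rightarrow> ('k, 'n, 'q) hom_module_scheme \<Rightarrow> ('a \<Rightarrow> 'n \<Rightarrow> 'n) \<Rightarrow>
     ('k, ('k, 'p, 'n) tensor set) module"
  where "balanced_tensor_space K P r A N l =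
    quotient_module (tensor_space K P N) (balanced_null K P r A N l)"

definition balanced_tens ::
    "('k, 'r) ring_scheme \<Rightarrow> ('k, 'p, 's) hom_module_scheme \<Rightarrow> ('p \<Rightarrow> 'a \<Rightarrow> 'p) \<Rightarrow>
     ('k, 'a, 't) hom_module_scheme \<Rightarrow> ('k, 'n, 'q) hom_module_scheme \<Rightarrow> ('a \<Rightarrow> 'n \<Rightarrow> 'n) \<Rightarrow>
     'p \<Rightarrow> 'n \<Rightarrow> ('k, 'p, 'n) tensor set"
  where "balanced_tens K P r A N l p n =
    balanced_null K P r A N l +>\<^bsub>tensor_space K P N\<^esub> tens K P N p n"

text \<open>\<open>A' \<otimes>\<^sub>A M\<close> and its elements \<open>b' \<otimes> m\<close>, with \<open>A\<close> acting on \<open>A'\<close> by \<open>b' \<cdot> a = b' \<beta>(a)\<close>\<close>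

definition induced_space ::
    "('k, 'r) ring_scheme \<Rightarrow> ('k, 'a, 's) hom_module_scheme \<Rightarrow> ('k, 'b, 't) hom_module_scheme \<Rightarrow>
     ('a \<Rightarrow> 'b) \<Rightarrow> ('k, 'm, 'a, 'c) doi_hopf_module \<Rightarrow> ('k, ('k, 'b, 'm) tensor set) module"
  where "induced_space K A A' \<beta> M =
    balanced_tensor_space K A' (\<lambda>b' a. b' \<otimes>\<^bsub>A'\<^esub> \<beta> a) A M (act M)"

definition induced_tens ::
    "('k, 'r) ring_scheme \<Rightarrow> ('k, 'a, 's) hom_module_scheme \<Rightarrow> ('k, 'b, 't) hom_module_scheme \<Rightarrow>
     ('a \<Rightarrow> 'b) \<Rightarrow> ('k, 'm, 'a, 'c) doi_hopf_module \<Rightarrow> 'b \<Rightarrow> 'm \<Rightarrow> ('k, 'b, 'm) tensor set"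
  where "induced_tens K A A' \<beta> M =
    balanced_tens K A' (\<lambda>b' a. b' \<otimes>\<^bsub>A'\<^esub> \<beta> a) A M (act M)"

end

theory Submission
  imports Defs
begin

text \<open>
  The classes \<open>b' \<otimes> m\<close> span \<open>A' \<otimes>\<^sub>A M\<close>, and a linear map out of this space is the same
  as a bilinear map on \<open>A' \<times> M\<close> that is balanced over \<open>A\<close>. So each structure map is defined by its
  formula on generators, once the formula is known to be balanced, and each axiom is an identity
  between linear maps that needs a proof on generators only. There it is a computation in Sweedler
  notation with the coactions of \<open>A'\<close> and \<open>M\<close>.

  The twist and the action are handled by Hom-associativity of \<open>A'\<close>. The coaction rests on the
  bilinear map \<open>\<kappa>(h, c) = \<alpha>\<^sup>-\<^sup>2(h \<cdot> \<gamma>(c))\<close> from \<open>H' \<times> C\<close> to \<open>C'\<close>, for which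
  \<open>\<rho>(b' \<otimes> m) = b'\<^sub>0 \<otimes> m\<^sub>0 \<otimes> \<kappa>(b'\<^sub>1, m\<^sub>1)\<close>.
  It commutes with the twists, the counits and the comultiplications (\<open>\<kappa>_twist\<close>, \<open>\<kappa>_counit\<close>,
  \<open>\<kappa>_comult\<close>), in other words it is a morphism of Hom-coalgebras \<open>H' \<otimes> C \<rightarrow> C'\<close>. Hence \<open>\<rho>\<close> is the
  diagonal coaction on the product of an \<open>H'\<close>-comodule and a \<open>C\<close>-comodule, pushed forward along \<open>\<kappa>\<close>,
  and this is coassociative because \<open>A'\<close> and \<open>M\<close> are and because independent Sweedler sums may be
  interchanged (\<open>tensor_lift_swap\<close>, \<open>J_coact_coact\<close>).

  Two further identities connect \<open>\<kappa>\<close> with the actions. In \<open>\<kappa>(g \<theta>(h), \<alpha>(c)) = \<kappa>(\<alpha>(g), h \<cdot> c)\<close>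
  (\<open>\<kappa>_balanced\<close>) the morphism of data enters, and it makes \<open>\<rho>\<close> balanced (\<open>coa_balanced\<close>). In
  \<open>\<kappa>(\<alpha>(h) g, \<alpha>(c)) = h \<cdot> \<kappa>(g, c)\<close> (\<open>\<kappa>_mult\<close>) Hom-associativity puts two twists
  on \<open>h\<close>, and these are what \<open>\<alpha>\<^sup>-\<^sup>2\<close> removes, which explains the exponent; the identity gives the compatibility of \<open>\<rho>\<close> with
  the action of \<open>A'\<close> (\<open>J_coact_act\<close>).

  A Sweedler sum is the value of a map \<open>tensor_lift\<close> at a tensor. Most of the preliminary part serves to
  compute with such nested sums: they may be rewritten below the binders, linear maps pass through
  them, and the multilinearity of a nested expression is decided by its shape (\<open>lin_rules\<close>).
\<close>

section \<open>Linear maps, spans and quotients\<close>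

lemma linear_mapsI:
  assumes "\<And>x. x \<in> carrier V \<Longrightarrow> f x \<in> carrier W"
    and "\<And>x y. x \<in> carrier V \<Longrightarrow> y \<in> carrier V \<Longrightarrow> f (x \<oplus>\<^bsub>V\<^esub> y) = f x \<oplus>\<^bsub>W\<^esub> f y"
    and "\<And>a x. a \<in> carrier K \<Longrightarrow> x \<in> carrier V \<Longrightarrow> f (a \<odot>\<^bsub>V\<^esub> x) = a \<odot>\<^bsub>W\<^esub> f x"
  shows "f \<in> linear_maps K V W"
  using assms by (auto simp: linear_maps_def)

lemma linear_maps_closed: "f \<in> linear_maps K V W \<Longrightarrow> x \<in> carrier V \<Longrightarrow> f x \<in> carrier W"
  and linear_maps_add: "f \<in> linear_maps K V W \<Longrightarrow> x \<in> carrier V \<Longrightarrow> y \<in> carrier V \<Longrightarrow>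
    f (x \<oplus>\<^bsub>V\<^esub> y) = f x \<oplus>\<^bsub>W\<^esub> f y"
  and linear_maps_smult: "f \<in> linear_maps K V W \<Longrightarrow> a \<in> carrier K \<Longrightarrow> x \<in> carrier V \<Longrightarrow>
    f (a \<odot>\<^bsub>V\<^esub> x) = a \<odot>\<^bsub>W\<^esub> f x"
  by (auto simp: linear_maps_def)

text \<open>
  Membership in \<open>linear_maps\<close> constrains a function on the carrier only.
\<close>

lemma linear_maps_cong:
  assumes "f \<in> linear_maps K V W" "module K V" "\<And>x. x \<in> carrier V \<Longrightarrow> g x = f x"
  shows "g \<in> linear_maps K V W"
proof -
  interpret V: module K V by fact
  show ?thesis using assms(1,3) by (auto simp: linear_maps_def)
qed

lemma linear_maps_comp:
  "f \<in> linear_maps K V W \<Longrightarrow> g \<in> linear_maps K W U \<Longrightarrow> (\<lambda>x. g (f x)) \<in> linear_maps K V U"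
  by (auto simp: linear_maps_def Pi_iff)

lemma linear_maps_zero:
  assumes "module K V" "module K W" "f \<in> linear_maps K V W"
  shows "f \<zero>\<^bsub>V\<^esub> = \<zero>\<^bsub>W\<^esub>"
proof -
  interpret V: module K V by fact
  interpret W: module K W by fact
  have "f \<zero>\<^bsub>V\<^esub> = f (\<zero>\<^bsub>K\<^esub> \<odot>\<^bsub>V\<^esub> \<zero>\<^bsub>V\<^esub>)" by simp
  also have "\<dots> = \<zero>\<^bsub>K\<^esub> \<odot>\<^bsub>W\<^esub> f \<zero>\<^bsub>V\<^esub>" by (rule linear_maps_smult[OF assms(3)]) auto
  also have "\<dots> = \<zero>\<^bsub>W\<^esub>" using linear_maps_closed[OF assms(3)] by simp
  finally show ?thesis .
qed

lemma module_minus_eq_zero_iff: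
  assumes "module K V" "x \<in> carrier V" "y \<in> carrier V"
  shows "x \<ominus>\<^bsub>V\<^esub> y = \<zero>\<^bsub>V\<^esub> \<longleftrightarrow> x = y"
proof -
  interpret V: module K V by fact
  have "x = (x \<ominus>\<^bsub>V\<^esub> y) \<oplus>\<^bsub>V\<^esub> y" using assms(2,3) by (simp add: a_minus_def V.a_assoc V.l_neg)
  then show ?thesis using assms(2,3) by (metis V.l_zero V.r_neg a_minus_def)
qed

lemma linear_maps_minus:
  assumes "module K V" "module K W" "f \<in> linear_maps K V W" "x \<in> carrier V" "y \<in> carrier V"
  shows "f (x \<ominus>\<^bsub>V\<^esub> y) = f x \<ominus>\<^bsub>W\<^esub> f y"
proof -
  interpret V: module K V by fact
  interpret W: module K W by fact
  have *: "f (\<ominus>\<^bsub>V\<^esub> y) = \<ominus>\<^bsub>W\<^esub> f y"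
    using linear_maps_smult[OF assms(3), of "\<ominus>\<^bsub>K\<^esub> \<one>\<^bsub>K\<^esub>" y] assms(5)
      linear_maps_closed[OF assms(3,5)]
    by (simp add: V.smult_l_minus W.smult_l_minus)
  show ?thesis
    using assms linear_maps_add[OF assms(3), of x "\<ominus>\<^bsub>V\<^esub> y"] by (simp add: a_minus_def *)
qed

lemma linear_maps_kernel_submodule:
  assumes "module K V" "module K W" "f \<in> linear_maps K V W"
  shows "submodule {x \<in> carrier V. f x = \<zero>\<^bsub>W\<^esub>} K V"
proof -
  interpret V: module K V by fact
  interpret W: module K W by fact
  note f = linear_maps_closed[OF assms(3)] linear_maps_add[OF assms(3)] linear_maps_smult[OF assms(3)]
    linear_maps_zero[OF assms]
  have neg: "f (\<ominus>\<^bsub>V\<^esub> x) = \<zero>\<^bsub>W\<^esub>" if "x \<in> carrier V" "f x = \<zero>\<^bsub>W\<^esub>" for x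
    using linear_maps_minus[OF assms V.zero_closed that(1)] that f
    by (simp add: a_minus_def)
  show ?thesis
    by (rule V.submoduleI) (auto simp: f neg)
qed

lemma submodule_span_submodule:
  assumes "module K V" "S \<subseteq> carrier V"
  shows "submodule (submodule_span K V S) K V"
proof -
  interpret V: module K V by fact
  have *: "submodule_span K V S \<subseteq> carrier V"
    using V.carrier_is_submodule assms(2) by (auto simp: submodule_span_def)
  have z: "\<zero>\<^bsub>V\<^esub> \<in> U" if "submodule U K V" for U
    using submodule.axioms(1)[OF that] by (auto dest: subgroup.one_closed)
  show ?thesis
    by (rule V.submoduleI[OF *])
       (auto simp: submodule_span_def intro: z V.submoduleE)
qed

lemma submodule_span_superset: "S \<subseteq> submodule_span K V S"
  by (auto simp: submodule_span_def)

lemma submodule_span_least: "submodule U K V \<Longrightarrow> S \<subseteq> U \<Longrightarrow> submodule_span K V S \<subseteq> U"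
  by (auto simp: submodule_span_def)

text \<open>
  The kernel of a linear map is a submodule. For this reason only the relations have to be tested
  when a map is to descend to a tensor product or to a balanced tensor product.
\<close>

lemma submodule_span_vanish:
  assumes "module K V" "module K W" "f \<in> linear_maps K V W" "S \<subseteq> carrier V"
    and "\<And>s. s \<in> S \<Longrightarrow> f s = \<zero>\<^bsub>W\<^esub>" and "x \<in> submodule_span K V S"
  shows "f x = \<zero>\<^bsub>W\<^esub>"
  using submodule_span_least[OF linear_maps_kernel_submodule[OF assms(1-3)], of S] assms(4-6)
  by auto

locale module_quotient = V: module K V for K (structure) and V (structure) and U +
  assumes submodule: "submodule U K V"
begin

sublocale U: abelian_subgroup U V
  by (rule abelian_subgroupI3)
     (use submodule in \<open>auto intro: additive_subgroupI submodule.axioms V.abelian_group_axioms\<close>)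

abbreviation "Q \<equiv> quotient_module V U"

lemma coset_eq_iff:
  assumes "x \<in> carrier V" "y \<in> carrier V"
  shows "U +>\<^bsub>V\<^esub> x = U +>\<^bsub>V\<^esub> y \<longleftrightarrow> x \<ominus>\<^bsub>V\<^esub> y \<in> U"
  unfolding a_minus_def U.a_rcos_module[OF assms(2,1), symmetric]
  using U.a_repr_independence'[of x y] U.a_rcos_self[OF assms(1)] assms(2) by metis

lemma carrier_quotient: "carrier Q = (\<lambda>x. U +>\<^bsub>V\<^esub> x) ` carrier V"
  by (auto simp: quotient_module_def A_RCOSETS_def')

lemma quotientE:
  assumes "X \<in> carrier Q" obtains x where "x \<in> carrier V" "X = U +>\<^bsub>V\<^esub> x"
  using assms by (auto simp: carrier_quotient)

lemma quotient_add: "x \<in> carrier V \<Longrightarrow> y \<in> carrier V \<Longrightarrow>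
    (U +>\<^bsub>V\<^esub> x) \<oplus>\<^bsub>Q\<^esub> (U +>\<^bsub>V\<^esub> y) = U +>\<^bsub>V\<^esub> (x \<oplus>\<^bsub>V\<^esub> y)"
  by (simp add: quotient_module_def U.a_rcos_sum)

text \<open>
  Scalar multiplication of a coset is defined as a union over its elements; all members of this
  union coincide.
\<close>

lemma quotient_smult:
  assumes a: "a \<in> carrier K" and x: "x \<in> carrier V"
  shows "a \<odot>\<^bsub>Q\<^esub> (U +>\<^bsub>V\<^esub> x) = U +>\<^bsub>V\<^esub> (a \<odot>\<^bsub>V\<^esub> x)"
proof -
  have *: "U +>\<^bsub>V\<^esub> (a \<odot>\<^bsub>V\<^esub> y) = U +>\<^bsub>V\<^esub> (a \<odot>\<^bsub>V\<^esub> x)" if "y \<in> U +>\<^bsub>V\<^esub> x" for y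
  proof -
    have y: "y \<in> carrier V" using U.a_elemrcos_carrier[OF x that] .
    have "y \<ominus>\<^bsub>V\<^esub> x \<in> U" using that U.a_rcos_module[OF x y] by (simp add: a_minus_def)
    then have "a \<odot>\<^bsub>V\<^esub> (y \<ominus>\<^bsub>V\<^esub> x) \<in> U" using a submodule by (simp add: submodule.smult_closed)
    moreover have "a \<odot>\<^bsub>V\<^esub> (y \<ominus>\<^bsub>V\<^esub> x) = a \<odot>\<^bsub>V\<^esub> y \<ominus>\<^bsub>V\<^esub> a \<odot>\<^bsub>V\<^esub> x"
      using a x y by (simp add: a_minus_def V.smult_r_distr V.smult_r_minus)
    ultimately show ?thesis 
      using coset_eq_iff[OF V.smult_closed[OF a y] V.smult_closed[OF a x]] by simp
  qed
  have "a \<odot>\<^bsub>Q\<^esub> (U +>\<^bsub>V\<^esub> x) = (\<Union>y\<in>U +>\<^bsub>V\<^esub> x. U +>\<^bsub>V\<^esub> (a \<odot>\<^bsub>V\<^esub> y))"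
    by (simp add: quotient_module_def)
  also have "\<dots> = (\<Union>y\<in>U +>\<^bsub>V\<^esub> x. U +>\<^bsub>V\<^esub> (a \<odot>\<^bsub>V\<^esub> x))"
    by (rule SUP_cong[OF refl *])
  also have "\<dots> = U +>\<^bsub>V\<^esub> (a \<odot>\<^bsub>V\<^esub> x)"
    using U.a_rcos_self[OF x] by blast
  finally show ?thesis .
qed

lemma quotient_zero: "\<zero>\<^bsub>Q\<^esub> = U +>\<^bsub>V\<^esub> \<zero>\<^bsub>V\<^esub>"
  using U.a_subset by (simp add: quotient_module_def)

lemma quotient_is_module: "module K Q"
proof (rule moduleI)
  show "cring K" by (rule V.R.is_cring)
  show "abelian_group Q"
  proof (rule abelian_groupI)
    fix X assume "X \<in> carrier Q"
    then obtain x where x: "x \<in> carrier V" "X = U +>\<^bsub>V\<^esub> x" by (rule quotientE)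
    show "\<exists>Y\<in>carrier Q. Y \<oplus>\<^bsub>Q\<^esub> X = \<zero>\<^bsub>Q\<^esub>"
      by (rule bexI[of _ "U +>\<^bsub>V\<^esub> (\<ominus>\<^bsub>V\<^esub> x)"])
         (use x in \<open>simp_all add: quotient_add quotient_zero carrier_quotient V.l_neg del: V.a_coset_add_zero\<close>)
  qed (auto elim!: quotientE simp: quotient_add quotient_zero V.a_ac carrier_quotient 
      simp del: V.a_coset_add_zero)
qed (auto elim!: quotientE simp: quotient_add quotient_smult V.smult_l_distr V.smult_r_distr
      V.smult_assoc1 carrier_quotient)

lemma coset_linear: "(\<lambda>x. U +>\<^bsub>V\<^esub> x) \<in> linear_maps K V Q"
  by (rule linear_mapsI) (auto simp: quotient_add quotient_smult carrier_quotient)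

lemma quotient_lift:
  assumes T: "module K T" and f: "f \<in> linear_maps K V T" and f0: "\<And>u. u \<in> U \<Longrightarrow> f u = \<zero>\<^bsub>T\<^esub>"
  obtains g where "g \<in> linear_maps K Q T" "g \<in> extensional (carrier Q)"
    "\<And>x. x \<in> carrier V \<Longrightarrow> g (U +>\<^bsub>V\<^esub> x) = f x"
proof -
  interpret T: module K T by fact
  note fc = linear_maps_closed[OF f]
  have inj: "f x = f y" if "x \<in> carrier V" "y \<in> carrier V" "U +>\<^bsub>V\<^esub> x = U +>\<^bsub>V\<^esub> y" for x y
    using f0[of "x \<ominus>\<^bsub>V\<^esub> y"] that linear_maps_minus[OF V.module_axioms T f, of x y] fc
    by (simp add: coset_eq_iff module_minus_eq_zero_iff[OF T])
  define g where "g = (\<lambda>X\<in>carrier Q. f (SOME x. x \<in> carrier V \<and> X = U +>\<^bsub>V\<^esub> x))"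
  have g: "g (U +>\<^bsub>V\<^esub> x) = f x" if "x \<in> carrier V" for x
  proof -
    define y where "y = (SOME y. y \<in> carrier V \<and> U +>\<^bsub>V\<^esub> x = U +>\<^bsub>V\<^esub> y)"
    have y: "y \<in> carrier V \<and> U +>\<^bsub>V\<^esub> x = U +>\<^bsub>V\<^esub> y" unfolding y_def
      by (rule someI[of _ x]) (use that in simp)
    have "g (U +>\<^bsub>V\<^esub> x) = f y" using that by (simp add: g_def carrier_quotient y_def)
    then show ?thesis using inj[of y x] y that by metis
  qed
  have "g \<in> linear_maps K Q T"
    by (rule linear_mapsI)
       (auto elim!: quotientE simp: quotient_add quotient_smult g fc linear_maps_add[OF f]
         linear_maps_smult[OF f])
  then show ?thesis using that g by (auto simp: g_def)
qed

end

section \<open>Free modules\<close>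

lemma free_module_is_module:
  assumes "cring K" shows "module K (free_module K X)"
proof -
  interpret K: cring K by fact
  have fin: "finite {x. f x \<oplus>\<^bsub>K\<^esub> g x \<noteq> \<zero>\<^bsub>K\<^esub>}"
    if "finite {x. f x \<noteq> \<zero>\<^bsub>K\<^esub>}" "finite {x. g x \<noteq> \<zero>\<^bsub>K\<^esub>}" for f g :: "'c \<Rightarrow> 'a"
    by (rule finite_subset[OF _ finite_UnI[OF that]]) auto
  have fin2: "finite {x. a \<otimes>\<^bsub>K\<^esub> f x \<noteq> \<zero>\<^bsub>K\<^esub>}"
    if "finite {x. f x \<noteq> \<zero>\<^bsub>K\<^esub>}" "a \<in> carrier K" for f :: "'c \<Rightarrow> 'a" and a
    by (rule finite_subset[OF _ that(1)]) (use that(2) in auto)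
  show ?thesis
  proof (rule moduleI)
    show "abelian_group (free_module K X)"
    proof (rule abelian_groupI)
      fix f assume f: "f \<in> carrier (free_module K X)"
      have "finite {x. \<ominus>\<^bsub>K\<^esub> f x \<noteq> \<zero>\<^bsub>K\<^esub>}"
        by (rule finite_subset[of _ "{x. f x \<noteq> \<zero>\<^bsub>K\<^esub>}"])
           (use f in \<open>auto simp: free_module_def\<close>)
      then show "\<exists>g\<in>carrier (free_module K X). g \<oplus>\<^bsub>free_module K X\<^esub> f = \<zero>\<^bsub>free_module K X\<^esub>"
        using f by (intro bexI[of _ "\<lambda>x. \<ominus>\<^bsub>K\<^esub> f x"]) (auto simp: free_module_def K.l_neg)
    qed (auto simp: free_module_def K.a_ac fin intro!: ext)
  qed (auto simp: free_module_def K.l_distr K.r_distr K.m_assoc fin2 intro!: ext K.is_cring)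
qed

lemma free_gen_closed:
  assumes "cring K" "x \<in> X" shows "free_gen K x \<in> carrier (free_module K X)"
proof -
  interpret K: cring K by fact
  have "finite {y. (if y = x then \<one>\<^bsub>K\<^esub> else \<zero>\<^bsub>K\<^esub>) \<noteq> \<zero>\<^bsub>K\<^esub>}"
    by (rule finite_subset[of _ "{x}"]) auto
  then show ?thesis using assms(2) by (auto simp: free_module_def free_gen_def)
qed

text \<open>
  Induction on the support: removing the value at one point leaves a function with smaller support.
\<close>

lemma free_module_induct [consumes 2, case_names gen add smult zero]:
  assumes K: "cring K" and f: "f \<in> carrier (free_module K X)"
    and gen: "\<And>x. x \<in> X \<Longrightarrow> P (free_gen K x)"
    and add: "\<And>f g. f \<in> carrier (free_module K X) \<Longrightarrow> g \<in> carrier (free_module K X) \<Longrightarrow>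
      P f \<Longrightarrow> P g \<Longrightarrow> P (f \<oplus>\<^bsub>free_module K X\<^esub> g)"
    and smult: "\<And>a f. a \<in> carrier K \<Longrightarrow> f \<in> carrier (free_module K X) \<Longrightarrow> P f \<Longrightarrow>
      P (a \<odot>\<^bsub>free_module K X\<^esub> f)"
    and zero: "P \<zero>\<^bsub>free_module K X\<^esub>"
  shows "P f"
proof -
  interpret K: cring K by fact
  interpret F: module K "free_module K X" by (rule free_module_is_module[OF K])
  have "\<forall>f. f \<in> carrier (free_module K X) \<longrightarrow> {x. f x \<noteq> \<zero>\<^bsub>K\<^esub>} = S \<longrightarrow> P f" if "finite S" for S
    using that
  proof (induction S)
    case empty
    then show ?case using zero by (auto simp: free_module_def)
  next
    case (insert s S)
    show ?case
    proof (intro allI impI)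
      fix f assume f: "f \<in> carrier (free_module K X)" and S: "{x. f x \<noteq> \<zero>\<^bsub>K\<^esub>} = insert s S"
      define g where "g = f(s := \<zero>\<^bsub>K\<^esub>)"
      have sX: "s \<in> X" using f S by (auto simp: free_module_def)
      have fs: "f s \<in> carrier K" using f by (auto simp: free_module_def)
      have gS: "{x. g x \<noteq> \<zero>\<^bsub>K\<^esub>} = S" using S insert.hyps by (auto simp: g_def)
      have g: "g \<in> carrier (free_module K X)" using f insert.hyps gS
        by (auto simp: free_module_def g_def)
      have "f = g \<oplus>\<^bsub>free_module K X\<^esub> (f s \<odot>\<^bsub>free_module K X\<^esub> free_gen K s)"
        using f by (auto simp: free_module_def g_def free_gen_def fun_eq_iff)
      moreover have "P \<dots>"
        by (intro add smult gen g fs sX free_gen_closed[OF K] F.smult_closed)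
           (use insert.IH g gS in auto)
      ultimately show "P f" by simp
    qed
  qed
  then show ?thesis using f by (auto simp: free_module_def)
qed

text \<open>
  The extension sends \<open>f\<close> to \<open>\<Sum> f x \<odot> g x\<close>, a finite sum over the support of \<open>f\<close>. Sums over larger
  finite sets give the same value, which is what makes the extension additive.
\<close>

lemma free_module_lift:
  assumes T: "module K T" and g: "\<And>x. x \<in> X \<Longrightarrow> g x \<in> carrier T"
  obtains L where "L \<in> linear_maps K (free_module K X) T" "\<And>x. x \<in> X \<Longrightarrow> L (free_gen K x) = g x"
proof -
  interpret T: module K T by fact
  let ?F = "free_module K X"
  let ?s = "\<lambda>f. {x. f x \<noteq> \<zero>\<^bsub>K\<^esub>}"
  define L where "L = (\<lambda>f. finsum T (\<lambda>x. f x \<odot>\<^bsub>T\<^esub> g x) (?s f))"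
  have fK: "f x \<in> carrier K" if "f \<in> carrier ?F" for f x using that by (auto simp: free_module_def)
  have sX: "?s f \<subseteq> X" "finite (?s f)" if "f \<in> carrier ?F" for f
    using that by (auto simp: free_module_def)
  have ext: "L f = finsum T (\<lambda>x. f x \<odot>\<^bsub>T\<^esub> g x) S"
    if "f \<in> carrier ?F" "finite S" "S \<subseteq> X" "?s f \<subseteq> S" for f S
    unfolding L_def
    by (rule T.add.finprod_mono_neutral_cong_left) (use that g fK in \<open>auto simp: subset_eq\<close>)
  interpret F: module K ?F by (rule free_module_is_module) (rule T.R.is_cring)
  have "L \<in> linear_maps K ?F T"
  proof (rule linear_mapsI)
    fix f assume f: "f \<in> carrier ?F"
    show "L f \<in> carrier T" unfolding L_def
      by (rule T.finsum_closed) (use f g fK sX(1)[OF f] in auto)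
    fix a assume a: "a \<in> carrier K"
    have af: "a \<odot>\<^bsub>?F\<^esub> f \<in> carrier ?F" using a f by simp
    have "L (a \<odot>\<^bsub>?F\<^esub> f) = finsum T (\<lambda>x. (a \<odot>\<^bsub>?F\<^esub> f) x \<odot>\<^bsub>T\<^esub> g x) (?s f)"
      by (rule ext[OF af sX(2,1)[OF f]]) (use a in \<open>auto simp: free_module_def\<close>)
    also have "\<dots> = finsum T (\<lambda>x. a \<odot>\<^bsub>T\<^esub> (f x \<odot>\<^bsub>T\<^esub> g x)) (?s f)"
    proof (rule T.finsum_cong'[OF refl])
      have c: "f x \<in> carrier K" "g x \<in> carrier T" if "x \<in> ?s f" for x
        using that fK[OF f] g sX(1)[OF f] by auto
      then show "(\<lambda>x. a \<odot>\<^bsub>T\<^esub> (f x \<odot>\<^bsub>T\<^esub> g x)) \<in> ?s f \<rightarrow> carrier T" using a by simp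
      show "(a \<odot>\<^bsub>?F\<^esub> f) x \<odot>\<^bsub>T\<^esub> g x = a \<odot>\<^bsub>T\<^esub> (f x \<odot>\<^bsub>T\<^esub> g x)" if "x \<in> ?s f" for x
        using T.smult_assoc1[OF a c[OF that]] by (simp add: free_module_def)
    qed
    also have "\<dots> = a \<odot>\<^bsub>T\<^esub> L f" unfolding L_def
      by (rule T.finsum_smult_ldistr[symmetric]) (use a f fK g sX[OF f] in auto)
    finally show "L (a \<odot>\<^bsub>?F\<^esub> f) = a \<odot>\<^bsub>T\<^esub> L f" .
  next
    fix f h assume f: "f \<in> carrier ?F" and h: "h \<in> carrier ?F"
    let ?S = "?s f \<union> ?s h"
    have S: "finite ?S" "?S \<subseteq> X" using sX[OF f] sX[OF h] by auto
    have c: "f x \<odot>\<^bsub>T\<^esub> g x \<in> carrier T" "h x \<odot>\<^bsub>T\<^esub> g x \<in> carrier T" if "x \<in> ?S" for x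
      using that S g fK f h by auto
    have "L (f \<oplus>\<^bsub>?F\<^esub> h) = finsum T (\<lambda>x. (f \<oplus>\<^bsub>?F\<^esub> h) x \<odot>\<^bsub>T\<^esub> g x) ?S"
      by (rule ext[OF F.a_closed[OF f h] S]) (use f h S in \<open>auto simp: free_module_def\<close>)
    also have "\<dots> = finsum T (\<lambda>x. f x \<odot>\<^bsub>T\<^esub> g x \<oplus>\<^bsub>T\<^esub> h x \<odot>\<^bsub>T\<^esub> g x) ?S"
    proof (rule T.finsum_cong'[OF refl])
      show "(\<lambda>x. f x \<odot>\<^bsub>T\<^esub> g x \<oplus>\<^bsub>T\<^esub> h x \<odot>\<^bsub>T\<^esub> g x) \<in> ?S \<rightarrow> carrier T"
        using c by blast
      show "(f \<oplus>\<^bsub>?F\<^esub> h) x \<odot>\<^bsub>T\<^esub> g x = f x \<odot>\<^bsub>T\<^esub> g x \<oplus>\<^bsub>T\<^esub> h x \<odot>\<^bsub>T\<^esub> g x" if "x \<in> ?S" for x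
        using T.smult_l_distr[OF fK[OF f] fK[OF h] g] S(2) that by (auto simp: free_module_def)
    qed
    also have "\<dots> = finsum T (\<lambda>x. f x \<odot>\<^bsub>T\<^esub> g x) ?S \<oplus>\<^bsub>T\<^esub> finsum T (\<lambda>x. h x \<odot>\<^bsub>T\<^esub> g x) ?S"
      by (rule T.finsum_addf) (use c in blast)+
    also have "\<dots> = L f \<oplus>\<^bsub>T\<^esub> L h"
      by (simp only: ext[OF f S Un_upper1] ext[OF h S Un_upper2])
    finally show "L (f \<oplus>\<^bsub>?F\<^esub> h) = L f \<oplus>\<^bsub>T\<^esub> L h" .
  qed
  moreover have "L (free_gen K x) = g x" if "x \<in> X" for x
  proof -
    have "L (free_gen K x) = finsum T (\<lambda>y. free_gen K x y \<odot>\<^bsub>T\<^esub> g y) {x}"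
      by (rule ext[OF free_gen_closed[OF T.R.is_cring that]]) (use that in \<open>auto simp: free_gen_def\<close>)
    then show ?thesis using g[OF that] by (simp add: free_gen_def)
  qed
  ultimately show ?thesis using that by blast
qed

section \<open>Tensor products\<close>

lemma bilinear_mapsI:
  assumes "\<And>v. v \<in> carrier V \<Longrightarrow> (\<lambda>w. b v w) \<in> linear_maps K W U"
    and "\<And>w. w \<in> carrier W \<Longrightarrow> (\<lambda>v. b v w) \<in> linear_maps K V U"
  shows "b \<in> bilinear_maps K V W U"
  using assms by (auto simp: bilinear_maps_def)

lemma bilinear_maps_right: "b \<in> bilinear_maps K V W U \<Longrightarrow> v \<in> carrier V \<Longrightarrow> b v \<in> linear_maps K W U"
  and bilinear_maps_left: "b \<in> bilinear_maps K V W U \<Longrightarrow> w \<in> carrier W \<Longrightarrow>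
    (\<lambda>v. b v w) \<in> linear_maps K V U"
  by (auto simp: bilinear_maps_def)

lemma bilinear_maps_closed:
  "b \<in> bilinear_maps K V W U \<Longrightarrow> v \<in> carrier V \<Longrightarrow> w \<in> carrier W \<Longrightarrow> b v w \<in> carrier U"
  by (auto simp: bilinear_maps_def linear_maps_def)

context
  fixes K :: "('k, 'r) ring_scheme" and V :: "('k, 'v, 's) module_scheme"
    and W :: "('k, 'w, 't) module_scheme"
  assumes V: "module K V" and W: "module K W"
begin

interpretation V: module K V by (rule V)
interpretation W: module K W by (rule W)

private abbreviation (input) "F \<equiv> free_module K (carrier V \<times> carrier W)"

interpretation F: module K F
  by (rule free_module_is_module) (rule V.R.is_cring)

lemma tensor_gen_closed:
  "v \<in> carrier V \<Longrightarrow> w \<in> carrier W \<Longrightarrow> free_gen K (v, w) \<in> carrier F"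
  by (rule free_gen_closed) (auto intro: V.R.is_cring)

lemma tensor_relations_subset: "tensor_relations K V W \<subseteq> carrier F"
proof
  fix r assume "r \<in> tensor_relations K V W"
  then show "r \<in> carrier F" unfolding tensor_relations_def Let_def
    by (elim UnE CollectE exE conjE; hypsubst)
       (intro F.minus_closed F.a_closed F.smult_closed tensor_gen_closed V.a_closed W.a_closed
         V.smult_closed W.smult_closed; assumption)+
qed

interpretation Q: module_quotient K F "tensor_null K V W"
  unfolding tensor_null_def
  by (intro module_quotient.intro module_quotient_axioms.intro F.module_axioms
      submodule_span_submodule[OF F.module_axioms tensor_relations_subset])

lemma tensor_space_module: "module K (tensor_space K V W)"
  unfolding tensor_space_def by (rule Q.quotient_is_module)

lemma tens_closed: "v \<in> carrier V \<Longrightarrow> w \<in> carrier W \<Longrightarrow> tens K V W v w \<in> carrier (tensor_space K V W)"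
  unfolding tensor_space_def tens_def Q.carrier_quotient using tensor_gen_closed by blast

lemma coset_eq_by_relation:
  assumes "x \<ominus>\<^bsub>F\<^esub> y \<in> tensor_relations K V W" "x \<in> carrier F" "y \<in> carrier F"
  shows "tensor_null K V W +>\<^bsub>F\<^esub> x = tensor_null K V W +>\<^bsub>F\<^esub> y"
  using Q.coset_eq_iff[OF assms(2,3)] assms(1) submodule_span_superset[of "tensor_relations K V W" K F]
  by (auto simp: tensor_null_def)

lemma tens_bilinear: "tens K V W \<in> bilinear_maps K V W (tensor_space K V W)"
proof (rule bilinear_mapsI; rule linear_mapsI)
  note e = tensor_gen_closed
  fix v w assume v: "v \<in> carrier V" and w: "w \<in> carrier W"
  show "tens K V W v w \<in> carrier (tensor_space K V W)"
    "tens K V W v w \<in> carrier (tensor_space K V W)" using v w by (auto intro: tens_closed)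
  show "tens K V W (v \<oplus>\<^bsub>V\<^esub> v') w = tens K V W v w \<oplus>\<^bsub>tensor_space K V W\<^esub> tens K V W v' w"
    if v': "v' \<in> carrier V" for v'
  proof -
    have "tensor_null K V W +>\<^bsub>F\<^esub> free_gen K (v \<oplus>\<^bsub>V\<^esub> v', w) =
      tensor_null K V W +>\<^bsub>F\<^esub> (free_gen K (v, w) \<oplus>\<^bsub>F\<^esub> free_gen K (v', w))"
      by (rule coset_eq_by_relation; (intro F.a_closed F.smult_closed e)?)
         (use v w v' in \<open>unfold tensor_relations_def Let_def, blast+\<close>)
    then show ?thesis using v w v' e unfolding tens_def tensor_space_def by (simp add: Q.quotient_add)
  qed
  show "tens K V W v (w \<oplus>\<^bsub>W\<^esub> w') = tens K V W v w \<oplus>\<^bsub>tensor_space K V W\<^esub> tens K V W v w'"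
    if w': "w' \<in> carrier W" for w'
  proof -
    have "tensor_null K V W +>\<^bsub>F\<^esub> free_gen K (v, w \<oplus>\<^bsub>W\<^esub> w') =
      tensor_null K V W +>\<^bsub>F\<^esub> (free_gen K (v, w) \<oplus>\<^bsub>F\<^esub> free_gen K (v, w'))"
      by (rule coset_eq_by_relation; (intro F.a_closed F.smult_closed e)?)
         (use v w w' in \<open>unfold tensor_relations_def Let_def, blast+\<close>)
    then show ?thesis using v w w' e unfolding tens_def tensor_space_def by (simp add: Q.quotient_add)
  qed
  fix a assume a: "a \<in> carrier K"
  have "tensor_null K V W +>\<^bsub>F\<^esub> free_gen K (a \<odot>\<^bsub>V\<^esub> v, w) =
      tensor_null K V W +>\<^bsub>F\<^esub> (a \<odot>\<^bsub>F\<^esub> free_gen K (v, w))"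
    by (rule coset_eq_by_relation; (intro F.a_closed F.smult_closed e)?)
         (use v w a in \<open>unfold tensor_relations_def Let_def, blast+\<close>)
  then show "tens K V W (a \<odot>\<^bsub>V\<^esub> v) w = a \<odot>\<^bsub>tensor_space K V W\<^esub> tens K V W v w"
    using v w a e unfolding tens_def tensor_space_def by (simp add: Q.quotient_smult)
  have "tensor_null K V W +>\<^bsub>F\<^esub> free_gen K (v, a \<odot>\<^bsub>W\<^esub> w) =
      tensor_null K V W +>\<^bsub>F\<^esub> (a \<odot>\<^bsub>F\<^esub> free_gen K (v, w))"
    by (rule coset_eq_by_relation; (intro F.a_closed F.smult_closed e)?)
         (use v w a in \<open>unfold tensor_relations_def Let_def, blast+\<close>)
  then show "tens K V W v (a \<odot>\<^bsub>W\<^esub> w) = a \<odot>\<^bsub>tensor_space K V W\<^esub> tens K V W v w"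
    using v w a e unfolding tens_def tensor_space_def by (simp add: Q.quotient_smult)
qed

text \<open>
  Pure tensors span. The zero tensor is the multiple \<open>0 \<odot> (0 \<otimes> 0)\<close>, so it needs no case of its own.
\<close>

lemma tensor_induct:
  assumes x: "x \<in> carrier (tensor_space K V W)"
    and t: "\<And>v w. v \<in> carrier V \<Longrightarrow> w \<in> carrier W \<Longrightarrow> P (tens K V W v w)"
    and add: "\<And>x y. x \<in> carrier (tensor_space K V W) \<Longrightarrow> y \<in> carrier (tensor_space K V W) \<Longrightarrow>
      P x \<Longrightarrow> P y \<Longrightarrow> P (x \<oplus>\<^bsub>tensor_space K V W\<^esub> y)"
    and smult: "\<And>a x. a \<in> carrier K \<Longrightarrow> x \<in> carrier (tensor_space K V W) \<Longrightarrow> P x \<Longrightarrow>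
      P (a \<odot>\<^bsub>tensor_space K V W\<^esub> x)"
  shows "P x"
proof -
  let ?T = "tensor_space K V W" and ?p = "\<lambda>f. tensor_null K V W +>\<^bsub>F\<^esub> f"
  interpret T: module K ?T by (rule tensor_space_module)
  have p: "?p \<in> linear_maps K F ?T" unfolding tensor_space_def by (rule Q.coset_linear)
  obtain f where f: "f \<in> carrier F" "x = ?p f"
    using x Q.quotientE unfolding tensor_space_def by metis
  have "P (?p f)" using V.R.is_cring f(1)
  proof (induction f rule: free_module_induct)
    case (gen z)
    then show ?case using t by (auto simp: tens_def)
  next
    case (add f g)
    then show ?case using linear_maps_closed[OF p] assms(3) by (simp add: linear_maps_add[OF p])
  next
    case (smult a f)
    then show ?case using linear_maps_closed[OF p] assms(4) by (simp add: linear_maps_smult[OF p])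
  next
    have "\<zero>\<^bsub>?T\<^esub> = \<zero>\<^bsub>K\<^esub> \<odot>\<^bsub>?T\<^esub> tens K V W \<zero>\<^bsub>V\<^esub> \<zero>\<^bsub>W\<^esub>" by (simp add: tens_closed)
    moreover have "P (\<zero>\<^bsub>K\<^esub> \<odot>\<^bsub>?T\<^esub> tens K V W \<zero>\<^bsub>V\<^esub> \<zero>\<^bsub>W\<^esub>)"
      by (intro smult t tens_closed) auto
    moreover have "?p \<zero>\<^bsub>F\<^esub> = \<zero>\<^bsub>?T\<^esub>"
      by (rule linear_maps_zero[OF F.module_axioms tensor_space_module p])
    ultimately show "P (?p \<zero>\<^bsub>F\<^esub>)" by simp
  qed
  then show ?thesis by (simp add: f)
qed

lemma tensor_linear_ext:
  assumes f: "f \<in> linear_maps K (tensor_space K V W) T" and g: "g \<in> linear_maps K (tensor_space K V W) T"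
    and eq: "\<And>v w. v \<in> carrier V \<Longrightarrow> w \<in> carrier W \<Longrightarrow> f (tens K V W v w) = g (tens K V W v w)"
    and x: "x \<in> carrier (tensor_space K V W)"
  shows "f x = g x"
  using x by (rule tensor_induct)
    (simp_all add: eq linear_maps_add[OF f] linear_maps_add[OF g] linear_maps_smult[OF f] linear_maps_smult[OF g])

text \<open>
  The universal property: the defining description of \<open>tensor_lift\<close> picks out a unique function,
  because a linear map is determined by its values on pure tensors and extensionality fixes it
  outside the carrier.
\<close>

lemma tensor_lift_props:
  assumes T: "module K T" and b: "b \<in> bilinear_maps K V W T"
  shows tensor_lift_linear: "tensor_lift K V W T b \<in> linear_maps K (tensor_space K V W) T"
    and tensor_lift_tens: "v \<in> carrier V \<Longrightarrow> w \<in> carrier W \<Longrightarrow> tensor_lift K V W T b (tens K V W v w) = b v w"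
proof -
  let ?T = "tensor_space K V W"
  let ?P = "\<lambda>f. f \<in> linear_maps K ?T T \<inter> extensional (carrier ?T) \<and>
      (\<forall>v\<in>carrier V. \<forall>w\<in>carrier W. f (tens K V W v w) = b v w)"
  interpret T: module K T by (rule T)
  interpret TT: module K ?T by (rule tensor_space_module)
  note bc = bilinear_maps_closed[OF b]
  obtain L where L: "L \<in> linear_maps K F T"
    and Lg: "\<And>z. z \<in> carrier V \<times> carrier W \<Longrightarrow> L (free_gen K z) = (\<lambda>(v, w). b v w) z"
    by (rule free_module_lift[OF T, of "carrier V \<times> carrier W" "\<lambda>(v, w). b v w"]) (use bc in auto)
  have Lg': "L (free_gen K (v, w)) = b v w" if "v \<in> carrier V" "w \<in> carrier W" for v w
    using Lg[of "(v, w)"] that by simp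
  note e = tensor_gen_closed
  have rel: "L r = \<zero>\<^bsub>T\<^esub>" if "r \<in> tensor_relations K V W" for r
  proof -
    have *: "L (x \<ominus>\<^bsub>F\<^esub> y) = \<zero>\<^bsub>T\<^esub>" if "x \<in> carrier F" "y \<in> carrier F" "L x = L y" for x y
      using linear_maps_minus[OF F.module_axioms T L that(1,2)] linear_maps_closed[OF L] that
        module_minus_eq_zero_iff[OF T] by simp
    note l = linear_maps_add[OF L] linear_maps_smult[OF L] linear_maps_add[OF bilinear_maps_left[OF b]]
      linear_maps_smult[OF bilinear_maps_left[OF b]] linear_maps_add[OF bilinear_maps_right[OF b]]
      linear_maps_smult[OF bilinear_maps_right[OF b]]
    show ?thesis using that unfolding tensor_relations_def Let_def
      by (elim UnE CollectE exE conjE) (simp_all only:, (rule *; simp add: e Lg' l)+)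
  qed
  have null: "L u = \<zero>\<^bsub>T\<^esub>" if "u \<in> tensor_null K V W" for u
    using submodule_span_vanish[OF F.module_axioms T L tensor_relations_subset rel] that
    by (simp add: tensor_null_def)
  obtain g where "g \<in> linear_maps K ?T T" "g \<in> extensional (carrier ?T)"
    "\<And>x. x \<in> carrier F \<Longrightarrow> g (tensor_null K V W +>\<^bsub>F\<^esub> x) = L x"
    unfolding tensor_space_def by (rule Q.quotient_lift[OF T L null]) auto
  then have "?P g" by (auto simp: tens_def e Lg')
  moreover have "g' = g" if "?P g'" "?P g" for g g'
    by (rule extensionalityI[of _ "carrier ?T"]) (use that in \<open>auto intro: tensor_linear_ext\<close>)
  ultimately have "?P (THE f. ?P f)" by (intro theI[of ?P g]) blast+
  then have "?P (tensor_lift K V W T b)" unfolding tensor_lift_def .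
  then show "tensor_lift K V W T b \<in> linear_maps K (tensor_space K V W) T"
    "v \<in> carrier V \<Longrightarrow> w \<in> carrier W \<Longrightarrow> tensor_lift K V W T b (tens K V W v w) = b v w" by auto
qed

end

lemma tensor_lift_cong:
  assumes "\<And>v w. v \<in> carrier V \<Longrightarrow> w \<in> carrier W \<Longrightarrow> b v w = b' v w"
  shows "tensor_lift K V W T b = tensor_lift K V W T b'"
  using assms by (simp add: tensor_lift_def)

section \<open>Multilinear maps in Sweedler notation\<close>

lemma lin_id: "(\<lambda>x. x) \<in> linear_maps K V V"
  by (simp add: linear_maps_def)

lemma bilin_left: "b \<in> bilinear_maps K V W U \<Longrightarrow> f \<in> linear_maps K P V \<Longrightarrow> w \<in> carrier W \<Longrightarrow>
    (\<lambda>p. b (f p) w) \<in> linear_maps K P U"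
  by (rule linear_maps_comp[OF _ bilinear_maps_left])

lemma bilin_right: "b \<in> bilinear_maps K V W U \<Longrightarrow> f \<in> linear_maps K P W \<Longrightarrow> v \<in> carrier V \<Longrightarrow>
    (\<lambda>p. b v (f p)) \<in> linear_maps K P U"
  by (rule linear_maps_comp[OF _ bilinear_maps_right])

lemmas tens_lin_left = bilin_left[OF tens_bilinear]
  and tens_lin_right = bilin_right[OF tens_bilinear]

lemma tensor_lift_closed:
  "module K V \<Longrightarrow> module K W \<Longrightarrow> module K T \<Longrightarrow> b \<in> bilinear_maps K V W T \<Longrightarrow>
    x \<in> carrier (tensor_space K V W) \<Longrightarrow> tensor_lift K V W T b x \<in> carrier T"
  by (blast intro: linear_maps_closed tensor_lift_linear)

lemma tensor_lift_lin:
  "module K V \<Longrightarrow> module K W \<Longrightarrow> module K T \<Longrightarrow> b \<in> bilinear_maps K V W T \<Longrightarrow>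
    f \<in> linear_maps K P (tensor_space K V W) \<Longrightarrow> (\<lambda>p. tensor_lift K V W T b (f p)) \<in> linear_maps K P T"
  by (rule linear_maps_comp[OF _ tensor_lift_linear])

lemma linear_maps_pointwise_add:
  assumes T: "module K T" and f: "f \<in> linear_maps K P T" and g: "g \<in> linear_maps K P T"
  shows "(\<lambda>p. f p \<oplus>\<^bsub>T\<^esub> g p) \<in> linear_maps K P T"
proof -
  interpret T: module K T by (rule T)
  note l = linear_maps_closed[OF f] linear_maps_closed[OF g] linear_maps_add[OF f] linear_maps_add[OF g]
    linear_maps_smult[OF f] linear_maps_smult[OF g]
  show ?thesis by (rule linear_mapsI) (simp_all add: l T.a_ac T.smult_r_distr)
qed

lemma linear_maps_pointwise_smult:
  assumes T: "module K T" and f: "f \<in> linear_maps K P T" and a: "a \<in> carrier K"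
  shows "(\<lambda>p. a \<odot>\<^bsub>T\<^esub> f p) \<in> linear_maps K P T"
proof -
  interpret T: module K T by (rule T)
  note l = linear_maps_closed[OF f] linear_maps_add[OF f] linear_maps_smult[OF f]
  show ?thesis by (rule linear_mapsI)
    (simp_all add: l a T.smult_r_distr T.smult_assoc1[symmetric] T.R.m_comm)
qed

text \<open>
  A Sweedler sum of terms that depend linearly on a parameter depends linearly on this parameter.
  On a pure tensor this is the assumption, and the linear maps in the parameter form a module.
\<close>

lemma tensor_lift_param:
  assumes P: "module K P" and V: "module K V" and W: "module K W" and T: "module K T"
    and b: "\<And>p. p \<in> carrier P \<Longrightarrow> b p \<in> bilinear_maps K V W T"
    and l: "\<And>v w. v \<in> carrier V \<Longrightarrow> w \<in> carrier W \<Longrightarrow> (\<lambda>p. b p v w) \<in> linear_maps K P T"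
    and x: "x \<in> carrier (tensor_space K V W)"
  shows "(\<lambda>p. tensor_lift K V W T (b p) x) \<in> linear_maps K P T"
  using x
proof (rule tensor_induct[OF V W])
  note L = tensor_lift_linear[OF V W T b]
  show "(\<lambda>p. tensor_lift K V W T (b p) (tens K V W v w)) \<in> linear_maps K P T"
    if "v \<in> carrier V" "w \<in> carrier W" for v w
    by (rule linear_maps_cong[OF l[OF that] P]) (simp add: tensor_lift_tens[OF V W T b that])
  show "(\<lambda>p. tensor_lift K V W T (b p) (x \<oplus>\<^bsub>tensor_space K V W\<^esub> y)) \<in> linear_maps K P T"
    if "x \<in> carrier (tensor_space K V W)" "y \<in> carrier (tensor_space K V W)"
      "(\<lambda>p. tensor_lift K V W T (b p) x) \<in> linear_maps K P T"
      "(\<lambda>p. tensor_lift K V W T (b p) y) \<in> linear_maps K P T" for x y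
    by (rule linear_maps_cong[OF linear_maps_pointwise_add[OF T that(3,4)] P])
       (simp add: linear_maps_add[OF L that(1,2)])
  show "(\<lambda>p. tensor_lift K V W T (b p) (a \<odot>\<^bsub>tensor_space K V W\<^esub> x)) \<in> linear_maps K P T"
    if "a \<in> carrier K" "x \<in> carrier (tensor_space K V W)"
      "(\<lambda>p. tensor_lift K V W T (b p) x) \<in> linear_maps K P T" for a x
    by (rule linear_maps_cong[OF linear_maps_pointwise_smult[OF T that(3,1)] P])
       (simp add: linear_maps_smult[OF L that(1,2)])
qed

text \<open>
  Linear maps may be moved inside a Sweedler sum.
\<close>

lemma linear_tensor_lift:
  assumes V: "module K V" and W: "module K W" and T: "module K T" and U: "module K U"
    and g: "g \<in> linear_maps K T U" and b: "b \<in> bilinear_maps K V W T"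
    and x: "x \<in> carrier (tensor_space K V W)"
  shows "g (tensor_lift K V W T b x) = tensor_lift K V W U (\<lambda>v w. g (b v w)) x"
proof (rule tensor_linear_ext[OF V W _ _ _ x])
  have b': "(\<lambda>v w. g (b v w)) \<in> bilinear_maps K V W U"
    by (rule bilinear_mapsI) (intro linear_maps_comp[OF _ g] bilin_left[OF b] bilin_right[OF b] lin_id; assumption)+
  show "(\<lambda>x. g (tensor_lift K V W T b x)) \<in> linear_maps K (tensor_space K V W) U"
    by (intro linear_maps_comp[OF _ g] tensor_lift_linear assms)
  show "tensor_lift K V W U (\<lambda>v w. g (b v w)) \<in> linear_maps K (tensor_space K V W) U"
    by (intro tensor_lift_linear b' assms)
  show "g (tensor_lift K V W T b (tens K V W v w)) = tensor_lift K V W U (\<lambda>v w. g (b v w)) (tens K V W v w)"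
    if "v \<in> carrier V" "w \<in> carrier W" for v w
    using that by (simp add: tensor_lift_tens[OF V W T b] tensor_lift_tens[OF V W U b'])
qed

lemma tensor_lift_id:
  assumes V: "module K V" and W: "module K W" and x: "x \<in> carrier (tensor_space K V W)"
  shows "tensor_lift K V W (tensor_space K V W) (tens K V W) x = x"
proof (rule tensor_linear_ext[OF V W _ lin_id _ x])
  note VW = tensor_space_module[OF V W]
  show "tensor_lift K V W (tensor_space K V W) (tens K V W) \<in> linear_maps K (tensor_space K V W) (tensor_space K V W)"
    by (intro tensor_lift_linear tens_bilinear assms VW)
qed (simp add: tensor_lift_tens[OF V W tensor_space_module[OF V W] tens_bilinear[OF V W]])

lemma tens_maps_bilinear:
  assumes "module K X" "module K Y" "f \<in> linear_maps K V X" "g \<in> linear_maps K W Y"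
  shows "(\<lambda>v w. tens K X Y (f v) (g w)) \<in> bilinear_maps K V W (tensor_space K X Y)"
  by (rule bilinear_mapsI)
     (use assms in \<open>auto intro: tens_lin_left tens_lin_right linear_maps_closed\<close>)

lemma tensor_map_linear:
  assumes "module K V" "module K W" "module K X" "module K Y"
    "f \<in> linear_maps K V X" "g \<in> linear_maps K W Y"
  shows "tensor_map K V W X Y f g \<in> linear_maps K (tensor_space K V W) (tensor_space K X Y)"
  unfolding tensor_map_def by (intro tensor_lift_linear tens_maps_bilinear tensor_space_module assms)

lemma tensor_map_tens:
  assumes "module K V" "module K W" "module K X" "module K Y"
    "f \<in> linear_maps K V X" "g \<in> linear_maps K W Y" "v \<in> carrier V" "w \<in> carrier W"
  shows "tensor_map K V W X Y f g (tens K V W v w) = tens K X Y (f v) (g w)"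
  unfolding tensor_map_def by (intro tensor_lift_tens tens_maps_bilinear tensor_space_module assms)

lemma tensor_map_cong:
  "(\<And>v. v \<in> carrier V \<Longrightarrow> f v = f' v) \<Longrightarrow> (\<And>w. w \<in> carrier W \<Longrightarrow> g w = g' w) \<Longrightarrow>
    tensor_map K V W X Y f g = tensor_map K V W X Y f' g'"
  unfolding tensor_map_def by (rule tensor_lift_cong) simp

lemma tensor_lift_tensor_map:
  assumes V: "module K V" and W: "module K W" and X: "module K X" and Y: "module K Y" and T: "module K T"
    and f: "f \<in> linear_maps K V X" and g: "g \<in> linear_maps K W Y"
    and b: "b \<in> bilinear_maps K X Y T" and x: "x \<in> carrier (tensor_space K V W)"
  shows "tensor_lift K X Y T b (tensor_map K V W X Y f g x) = tensor_lift K V W T (\<lambda>v w. b (f v) (g w)) x"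
proof -
  have "tensor_lift K X Y T b (tensor_map K V W X Y f g x) =
      tensor_lift K V W T (\<lambda>v w. tensor_lift K X Y T b (tens K X Y (f v) (g w))) x"
    unfolding tensor_map_def
    by (rule linear_tensor_lift[OF V W tensor_space_module[OF X Y] T tensor_lift_linear[OF X Y T b]
          tens_maps_bilinear[OF X Y f g] x])
  also have "\<dots> = tensor_lift K V W T (\<lambda>v w. b (f v) (g w)) x"
    by (rule arg_cong[where f = "\<lambda>f. f x"], rule tensor_lift_cong)
       (simp add: tensor_lift_tens[OF X Y T b] linear_maps_closed[OF f] linear_maps_closed[OF g])
  finally show ?thesis .
qed

text \<open>
  Two independent Sweedler sums may be interchanged. Both sides are linear in the tensor \<open>x\<close>, and for a
  pure tensor one of the two sums disappears on either side.
\<close>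

lemma tensor_lift_swap:
  assumes V: "module K V" and W: "module K W" and X: "module K X" and Y: "module K Y" and T: "module K T"
    and b1: "\<And>w p q. w \<in> carrier W \<Longrightarrow> p \<in> carrier X \<Longrightarrow> q \<in> carrier Y \<Longrightarrow>
      (\<lambda>v. b v w p q) \<in> linear_maps K V T"
    and b2: "\<And>v p q. v \<in> carrier V \<Longrightarrow> p \<in> carrier X \<Longrightarrow> q \<in> carrier Y \<Longrightarrow>
      (\<lambda>w. b v w p q) \<in> linear_maps K W T"
    and b3: "\<And>v w q. v \<in> carrier V \<Longrightarrow> w \<in> carrier W \<Longrightarrow> q \<in> carrier Y \<Longrightarrow>
      (\<lambda>p. b v w p q) \<in> linear_maps K X T"
    and b4: "\<And>v w p. v \<in> carrier V \<Longrightarrow> w \<in> carrier W \<Longrightarrow> p \<in> carrier X \<Longrightarrow>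
      (\<lambda>q. b v w p q) \<in> linear_maps K Y T"
    and x: "x \<in> carrier (tensor_space K V W)" and y: "y \<in> carrier (tensor_space K X Y)"
  shows "tensor_lift K V W T (\<lambda>v w. tensor_lift K X Y T (b v w) y) x =
    tensor_lift K X Y T (\<lambda>p q. tensor_lift K V W T (\<lambda>v w. b v w p q) x) y"
proof (rule tensor_linear_ext[OF V W _ _ _ x])
  let ?T = "tensor_space K V W"
  have bXY: "b v w \<in> bilinear_maps K X Y T" if "v \<in> carrier V" "w \<in> carrier W" for v w
    by (rule bilinear_mapsI) (use b3 b4 that in auto)
  have bVW: "(\<lambda>v w. b v w p q) \<in> bilinear_maps K V W T" if "p \<in> carrier X" "q \<in> carrier Y" for p q
    by (rule bilinear_mapsI) (use b1 b2 that in auto)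
  have 1: "(\<lambda>v w. tensor_lift K X Y T (b v w) y) \<in> bilinear_maps K V W T"
    by (rule bilinear_mapsI; rule tensor_lift_param[OF _ X Y T _ _ y]) (use V W bXY b1 b2 in auto)
  have 2: "(\<lambda>p q. tensor_lift K V W T (\<lambda>v w. b v w p q) x) \<in> bilinear_maps K X Y T"
    if "x \<in> carrier ?T" for x
    by (rule bilinear_mapsI; rule tensor_lift_param[OF _ V W T _ _ that]) (use X Y bVW b3 b4 in auto)
  show "tensor_lift K V W T (\<lambda>v w. tensor_lift K X Y T (b v w) y) \<in> linear_maps K ?T T"
    by (rule tensor_lift_linear[OF V W T 1])
  show "(\<lambda>x. tensor_lift K X Y T (\<lambda>p q. tensor_lift K V W T (\<lambda>v w. b v w p q) x) y) \<in> linear_maps K ?T T"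
    by (rule tensor_lift_param[OF tensor_space_module[OF V W] X Y T 2 _ y])
       (auto intro: tensor_lift_linear[OF V W T bVW])
  fix v w assume vw: "v \<in> carrier V" "w \<in> carrier W"
  have "tensor_lift K X Y T (b v w) y =
      tensor_lift K X Y T (\<lambda>p q. tensor_lift K V W T (\<lambda>v w. b v w p q) (tens K V W v w)) y"
    by (rule arg_cong[where f = "\<lambda>f. f y"], rule tensor_lift_cong)
       (simp add: tensor_lift_tens[OF V W T bVW] vw)
  then show "tensor_lift K V W T (\<lambda>v w. tensor_lift K X Y T (b v w) y) (tens K V W v w) =
      tensor_lift K X Y T (\<lambda>p q. tensor_lift K V W T (\<lambda>v w. b v w p q) (tens K V W v w)) y"
    using vw by (simp add: tensor_lift_tens[OF V W T 1])
qed

lemma tensor_map_param_right: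
  assumes "module K P" "module K V" "module K W" "module K X" "module K Y" 
    and "f \<in> linear_maps K V X" and "\<And>p. p \<in> carrier P \<Longrightarrow> g p \<in> linear_maps K W Y"
    and "\<And>w. w \<in> carrier W \<Longrightarrow> (\<lambda>p. g p w) \<in> linear_maps K P Y"
    and "x \<in> carrier (tensor_space K V W)"
  shows "(\<lambda>p. tensor_map K V W X Y f (g p) x) \<in> linear_maps K P (tensor_space K X Y)"
  unfolding tensor_map_def
  by (rule tensor_lift_param)
     (use assms in \<open>auto intro: tensor_space_module tens_maps_bilinear tens_lin_right linear_maps_closed\<close>)

lemma tensor_map_param_left:
  assumes "module K P" "module K V" "module K W" "module K X" "module K Y" 
    and "g \<in> linear_maps K W Y" and "\<And>p. p \<in> carrier P \<Longrightarrow> f p \<in> linear_maps K V X"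
    and "\<And>v. v \<in> carrier V \<Longrightarrow> (\<lambda>p. f p v) \<in> linear_maps K P X"
    and "x \<in> carrier (tensor_space K V W)"
  shows "(\<lambda>p. tensor_map K V W X Y (f p) g x) \<in> linear_maps K P (tensor_space K X Y)"
  unfolding tensor_map_def
  by (rule tensor_lift_param)
     (use assms in \<open>auto intro: tensor_space_module tens_maps_bilinear tens_lin_left linear_maps_closed\<close>)

lemma tensor_lift_tensor_bimap:
  assumes V: "module K V" and W: "module K W" and V': "module K V'" and W': "module K W'"
    and X: "module K X" and Y: "module K Y" and T: "module K T"
    and f: "f \<in> bilinear_maps K V V' X" and g: "g \<in> bilinear_maps K W W' Y"
    and b: "b \<in> bilinear_maps K X Y T" 
    and s: "s \<in> carrier (tensor_space K V W)" and t: "t \<in> carrier (tensor_space K V' W')"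
  shows "tensor_lift K X Y T b (tensor_bimap K V W V' W' X Y f g s t) =
    tensor_lift K V W T (\<lambda>v w. tensor_lift K V' W' T (\<lambda>v' w'. b (f v v') (g w w')) t) s"
proof -
  have 1: "(\<lambda>v w. tensor_map K V' W' X Y (f v) (g w) t) \<in> bilinear_maps K V W (tensor_space K X Y)"
    by (rule bilinear_mapsI; (rule tensor_map_param_right | rule tensor_map_param_left))
       (use assms in \<open>auto intro: bilinear_maps_left bilinear_maps_right\<close>)
  have "tensor_lift K X Y T b (tensor_bimap K V W V' W' X Y f g s t) =
      tensor_lift K V W T (\<lambda>v w. tensor_lift K X Y T b (tensor_map K V' W' X Y (f v) (g w) t)) s"
    unfolding tensor_bimap_def
    by (rule linear_tensor_lift[OF V W tensor_space_module[OF X Y] T tensor_lift_linear[OF X Y T b] 1 s])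
  also have "\<dots> = tensor_lift K V W T (\<lambda>v w. tensor_lift K V' W' T (\<lambda>v' w'. b (f v v') (g w w')) t) s"
    by (rule arg_cong[where f = "\<lambda>f. f s"], rule tensor_lift_cong, rule tensor_lift_tensor_map)
       (use assms in \<open>auto intro: bilinear_maps_right\<close>)
  finally show ?thesis .
qed

lemma tensor_assoc_props:
  assumes U: "module K U" and V: "module K V" and W: "module K W"
  shows tensor_assoc_linear: "tensor_assoc K U V W \<in> linear_maps K
      (tensor_space K (tensor_space K U V) W) (tensor_space K U (tensor_space K V W))"
    and tensor_assoc_tens: "s \<in> carrier (tensor_space K U V) \<Longrightarrow> w \<in> carrier W \<Longrightarrow>
      tensor_assoc K U V W (tens K (tensor_space K U V) W s w) =
      tensor_lift K U V (tensor_space K U (tensor_space K V W))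
        (\<lambda>u v. tens K U (tensor_space K V W) u (tens K V W v w)) s"
proof -
  let ?VW = "tensor_space K V W" let ?T = "tensor_space K U ?VW" and ?UV = "tensor_space K U V"
  note m = tensor_space_module
  have 1: "(\<lambda>u v. tens K U ?VW u (tens K V W v w)) \<in> bilinear_maps K U V ?T" if "w \<in> carrier W" for w
    by (rule bilinear_mapsI) (use assms that in \<open>auto intro!: tens_lin_left tens_lin_right lin_id m tens_closed\<close>)
  have 2: "(\<lambda>s w. tensor_lift K U V ?T (\<lambda>u v. tens K U ?VW u (tens K V W v w)) s) \<in> bilinear_maps K ?UV W ?T"
  proof (rule bilinear_mapsI)
    show "(\<lambda>w. tensor_lift K U V ?T (\<lambda>u v. tens K U ?VW u (tens K V W v w)) s) \<in> linear_maps K W ?T"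
      if "s \<in> carrier ?UV" for s
      by (rule tensor_lift_param)
         (use assms that 1 in \<open>auto intro!: tens_lin_left tens_lin_right lin_id m tens_closed\<close>)
    show "tensor_lift K U V ?T (\<lambda>u v. tens K U ?VW u (tens K V W v w)) \<in> linear_maps K ?UV ?T"
      if "w \<in> carrier W" for w
      by (rule tensor_lift_linear) (use assms that 1 in \<open>auto intro!: m\<close>)
  qed
  show "tensor_assoc K U V W \<in> linear_maps K (tensor_space K ?UV W) ?T"
    unfolding tensor_assoc_def Let_def by (rule tensor_lift_linear) (intro m assms 2)+
  show "s \<in> carrier ?UV \<Longrightarrow> w \<in> carrier W \<Longrightarrow> tensor_assoc K U V W (tens K ?UV W s w) =
      tensor_lift K U V ?T (\<lambda>u v. tens K U ?VW u (tens K V W v w)) s"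
    unfolding tensor_assoc_def Let_def by (rule tensor_lift_tens) (intro m assms 2 | assumption)+
qed

lemma tensor_lift_arg_cong:
  "(\<And>v w. v \<in> carrier V \<Longrightarrow> w \<in> carrier W \<Longrightarrow> b v w = b' v w) \<Longrightarrow>
    tensor_lift K V W T b x = tensor_lift K V W T b' x"
  by (simp cong: tensor_lift_cong)

text \<open>
  As a congruence rule this lets the simplifier rewrite the terms of a Sweedler sum, with the
  variables known to lie in the carriers.
\<close>

lemma tensor_lift_sweedler_cong:
  "x = x' \<Longrightarrow> (\<And>v w. v \<in> carrier V \<Longrightarrow> w \<in> carrier W \<Longrightarrow> b v w = b' v w) \<Longrightarrow>
    tensor_lift K V W T b x = tensor_lift K V W T b' x'"
  using tensor_lift_arg_cong by metis

lemma linear_as_tensor_lift: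
  assumes V: "module K V" and W: "module K W" and T: "module K T"
    and g: "g \<in> linear_maps K (tensor_space K V W) T" and x: "x \<in> carrier (tensor_space K V W)"
  shows "g x = tensor_lift K V W T (\<lambda>v w. g (tens K V W v w)) x"
  using linear_tensor_lift[OF V W tensor_space_module[OF V W] T g tens_bilinear[OF V W] x]
    tensor_lift_id[OF V W x] by simp

text \<open>
  With the outer map as the first premise, a whole list of known linear maps can be turned into rules by
  \<open>THEN\<close>.
\<close>

lemma lin_comp: "g \<in> linear_maps K W U \<Longrightarrow> f \<in> linear_maps K V W \<Longrightarrow> (\<lambda>x. g (f x)) \<in> linear_maps K V U"
  by (rule linear_maps_comp)

text \<open>
  Introduction rules that follow the shape of a term. Used by the simplifier together with the
  closure facts of the operations involved, they settle the multilinearity of nested Sweedler sums.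
\<close>

lemmas lin_rules = bilinear_mapsI lin_id tens_lin_left tens_lin_right tensor_lift_param tensor_lift_lin
  tens_closed tensor_lift_closed tensor_space_module

section \<open>Balanced tensor products\<close>

text \<open>
  The linear map on \<open>P \<otimes>\<^sub>A N\<close> induced by a balanced bilinear map \<open>b\<close>, described as
  \<open>tensor_lift\<close> is for \<open>P \<otimes> N\<close>.
\<close>

definition balanced_lift ::
    "('k, 'r) ring_scheme \<Rightarrow> ('k, 'p, 's) hom_module_scheme \<Rightarrow> ('p \<Rightarrow> 'a \<Rightarrow> 'p) \<Rightarrow>
     ('k, 'a, 't) hom_module_scheme \<Rightarrow> ('k, 'n, 'q) hom_module_scheme \<Rightarrow> ('a \<Rightarrow> 'n \<Rightarrow> 'n) \<Rightarrow>
     ('k, 'u, 'w) module_scheme \<Rightarrow> ('p \<Rightarrow> 'n \<Rightarrow> 'u) \<Rightarrow> ('k, 'p, 'n) tensor set \<Rightarrow> 'u"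
  where "balanced_lift K P r A N l T b =
    (THE f. f \<in> linear_maps K (balanced_tensor_space K P r A N l) T \<inter>
        extensional (carrier (balanced_tensor_space K P r A N l)) \<and>
      (\<forall>p\<in>carrier P. \<forall>n\<in>carrier N. f (balanced_tens K P r A N l p n) = b p n))"

context
  fixes K :: "('k, 'r) ring_scheme" and P :: "('k, 'p, 's) hom_module_scheme" and r :: "'p \<Rightarrow> 'a \<Rightarrow> 'p"
    and A :: "('k, 'a, 't) hom_module_scheme" and N :: "('k, 'n, 'q) hom_module_scheme"
    and l :: "'a \<Rightarrow> 'n \<Rightarrow> 'n"
  assumes P: "module K P" and N: "module K N"
    and twist_P: "p \<in> carrier P \<Longrightarrow> twist P p \<in> carrier P"
    and twist_N: "n \<in> carrier N \<Longrightarrow> twist N n \<in> carrier N"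
    and r_closed: "p \<in> carrier P \<Longrightarrow> a \<in> carrier A \<Longrightarrow> r p a \<in> carrier P"
    and l_closed: "a \<in> carrier A \<Longrightarrow> n \<in> carrier N \<Longrightarrow> l a n \<in> carrier N"
begin

interpretation T: module K "tensor_space K P N" by (rule tensor_space_module[OF P N])

private abbreviation (input) "Rel \<equiv>
    {tens K P N (r p a) (twist N n) \<ominus>\<^bsub>tensor_space K P N\<^esub> tens K P N (twist P p) (l a n) |
      p a n. p \<in> carrier P \<and> a \<in> carrier A \<and> n \<in> carrier N}"

lemma balanced_relations_subset: "Rel \<subseteq> carrier (tensor_space K P N)"
proof
  fix x assume "x \<in> Rel"
  then show "x \<in> carrier (tensor_space K P N)"
    by (elim CollectE exE conjE; hypsubst)
       (intro T.minus_closed tens_closed P N twist_P twist_N r_closed l_closed; assumption)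
qed

interpretation Q: module_quotient K "tensor_space K P N" "balanced_null K P r A N l"
  unfolding balanced_null_def
  by (intro module_quotient.intro module_quotient_axioms.intro T.module_axioms
      submodule_span_submodule[OF T.module_axioms balanced_relations_subset])

lemma balanced_tensor_space_module: "module K (balanced_tensor_space K P r A N l)"
  unfolding balanced_tensor_space_def by (rule Q.quotient_is_module)

lemma balanced_tens_bilinear:
  "balanced_tens K P r A N l \<in> bilinear_maps K P N (balanced_tensor_space K P r A N l)"
  unfolding balanced_tensor_space_def balanced_tens_def
  by (rule bilinear_mapsI)
     (intro linear_maps_comp[OF _ Q.coset_linear] tens_lin_left tens_lin_right lin_id P N; assumption)+

lemma balanced_tens_balanced:
  assumes "p \<in> carrier P" "a \<in> carrier A" "n \<in> carrier N"
  shows "balanced_tens K P r A N l (r p a) (twist N n) = balanced_tens K P r A N l (twist P p) (l a n)"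
proof -
  have "tens K P N (r p a) (twist N n) \<ominus>\<^bsub>tensor_space K P N\<^esub> tens K P N (twist P p) (l a n) \<in>
      balanced_null K P r A N l"
    unfolding balanced_null_def by (rule subsetD[OF submodule_span_superset]) (use assms in blast)
  then show ?thesis unfolding balanced_tens_def
    using Q.coset_eq_iff[OF tens_closed tens_closed, OF P N _ _ P N]
      r_closed[OF assms(1,2)] l_closed[OF assms(2,3)] twist_P[OF assms(1)] twist_N[OF assms(3)]
    by blast
qed

lemma balanced_induct:
  assumes x: "x \<in> carrier (balanced_tensor_space K P r A N l)"
    and t: "\<And>p n. p \<in> carrier P \<Longrightarrow> n \<in> carrier N \<Longrightarrow> Pr (balanced_tens K P r A N l p n)"
    and add: "\<And>x y. x \<in> carrier (balanced_tensor_space K P r A N l) \<Longrightarrow>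
      y \<in> carrier (balanced_tensor_space K P r A N l) \<Longrightarrow> Pr x \<Longrightarrow> Pr y \<Longrightarrow>
      Pr (x \<oplus>\<^bsub>balanced_tensor_space K P r A N l\<^esub> y)"
    and smult: "\<And>a x. a \<in> carrier K \<Longrightarrow> x \<in> carrier (balanced_tensor_space K P r A N l) \<Longrightarrow> Pr x \<Longrightarrow>
      Pr (a \<odot>\<^bsub>balanced_tensor_space K P r A N l\<^esub> x)"
  shows "Pr x"
proof -
  let ?p = "\<lambda>f. balanced_null K P r A N l +>\<^bsub>tensor_space K P N\<^esub> f"
  have p: "?p \<in> linear_maps K (tensor_space K P N) (balanced_tensor_space K P r A N l)"
    unfolding balanced_tensor_space_def by (rule Q.coset_linear)
  obtain f where f: "f \<in> carrier (tensor_space K P N)" "x = ?p f"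
    using x Q.quotientE unfolding balanced_tensor_space_def by metis
  have "Pr (?p f)" using f(1)
  proof (rule tensor_induct[OF P N])
    show "Pr (?p (tens K P N v w))" if "v \<in> carrier P" "w \<in> carrier N" for v w
      using t[OF that] by (simp add: balanced_tens_def)
    show "Pr (?p (x \<oplus>\<^bsub>tensor_space K P N\<^esub> y))" if "x \<in> carrier (tensor_space K P N)"
      "y \<in> carrier (tensor_space K P N)" "Pr (?p x)" "Pr (?p y)" for x y
      using add[OF linear_maps_closed[OF p that(1)] linear_maps_closed[OF p that(2)] that(3,4)]
      by (simp add: linear_maps_add[OF p that(1,2)])
    show "Pr (?p (a \<odot>\<^bsub>tensor_space K P N\<^esub> x))" if "a \<in> carrier K" "x \<in> carrier (tensor_space K P N)"
      "Pr (?p x)" for a x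
      using smult[OF that(1) linear_maps_closed[OF p that(2)] that(3)]
      by (simp add: linear_maps_smult[OF p that(1,2)])
  qed
  then show ?thesis by (simp add: f)
qed

lemma balanced_linear_ext:
  assumes f: "f \<in> linear_maps K (balanced_tensor_space K P r A N l) T"
    and g: "g \<in> linear_maps K (balanced_tensor_space K P r A N l) T"
    and eq: "\<And>p n. p \<in> carrier P \<Longrightarrow> n \<in> carrier N \<Longrightarrow>
      f (balanced_tens K P r A N l p n) = g (balanced_tens K P r A N l p n)"
    and x: "x \<in> carrier (balanced_tensor_space K P r A N l)"
  shows "f x = g x"
  using x by (rule balanced_induct)
    (simp_all add: eq linear_maps_add[OF f] linear_maps_add[OF g] linear_maps_smult[OF f] linear_maps_smult[OF g])

text \<open>
  The universal property of \<open>P \<otimes>\<^sub>A N\<close>. A balanced bilinear map vanishes on the relations when it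
  is extended to \<open>P \<otimes> N\<close>, so it factors through the quotient.
\<close>

lemma balanced_lift_props:
  assumes T: "module K T" and b: "b \<in> bilinear_maps K P N T"
    and bal: "\<And>p a n. p \<in> carrier P \<Longrightarrow> a \<in> carrier A \<Longrightarrow> n \<in> carrier N \<Longrightarrow>
      b (r p a) (twist N n) = b (twist P p) (l a n)"
  shows balanced_lift_linear: "balanced_lift K P r A N l T b \<in> linear_maps K (balanced_tensor_space K P r A N l) T"
    and balanced_lift_tens: "p \<in> carrier P \<Longrightarrow> n \<in> carrier N \<Longrightarrow>
      balanced_lift K P r A N l T b (balanced_tens K P r A N l p n) = b p n"
    and balanced_lift_extensional:
      "balanced_lift K P r A N l T b \<in> extensional (carrier (balanced_tensor_space K P r A N l))"
proof -
  let ?B = "balanced_tensor_space K P r A N l"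
  let ?P = "\<lambda>f. f \<in> linear_maps K ?B T \<inter> extensional (carrier ?B) \<and>
      (\<forall>p\<in>carrier P. \<forall>n\<in>carrier N. f (balanced_tens K P r A N l p n) = b p n)"
  let ?L = "tensor_lift K P N T b"
  have L: "?L \<in> linear_maps K (tensor_space K P N) T" by (rule tensor_lift_linear[OF P N T b])
  note Lt = tensor_lift_tens[OF P N T b]
  have rel: "?L s = \<zero>\<^bsub>T\<^esub>" if s0: "s \<in> Rel" for s
  proof -
    obtain p a n where s: "p \<in> carrier P" "a \<in> carrier A" "n \<in> carrier N"
      "s = tens K P N (r p a) (twist N n) \<ominus>\<^bsub>tensor_space K P N\<^esub> tens K P N (twist P p) (l a n)"
      using s0 by blast
    note c = r_closed[OF s(1,2)] l_closed[OF s(2,3)] twist_P[OF s(1)] twist_N[OF s(3)]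
    note t = tens_closed[OF P N c(1,4)] tens_closed[OF P N c(3,2)]
    show ?thesis unfolding s(4) linear_maps_minus[OF T.module_axioms T L t] Lt[OF c(1,4)] Lt[OF c(3,2)]
      using module_minus_eq_zero_iff[OF T] bilinear_maps_closed[OF b] c bal[OF s(1-3)] by simp
  qed
  have null: "?L u = \<zero>\<^bsub>T\<^esub>" if "u \<in> balanced_null K P r A N l" for u
    by (rule submodule_span_vanish[OF T.module_axioms T L balanced_relations_subset rel
          that[unfolded balanced_null_def]])
  obtain g where "g \<in> linear_maps K ?B T" "g \<in> extensional (carrier ?B)"
    "\<And>x. x \<in> carrier (tensor_space K P N) \<Longrightarrow>
      g (balanced_null K P r A N l +>\<^bsub>tensor_space K P N\<^esub> x) = ?L x"
    unfolding balanced_tensor_space_def by (rule Q.quotient_lift[OF T L null]) auto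
  then have "?P g" by (simp add: balanced_tens_def tens_closed[OF P N] Lt)
  moreover have "g' = g" if "?P g'" "?P g" for g g'
    by (rule extensionalityI[of _ "carrier ?B"]) (use that in \<open>auto intro: balanced_linear_ext\<close>)
  ultimately have "?P (THE f. ?P f)" by (intro theI[of ?P g]) blast+
  then have "?P (balanced_lift K P r A N l T b)" unfolding balanced_lift_def .
  then show "balanced_lift K P r A N l T b \<in> linear_maps K ?B T"
    "p \<in> carrier P \<Longrightarrow> n \<in> carrier N \<Longrightarrow>
      balanced_lift K P r A N l T b (balanced_tens K P r A N l p n) = b p n"
    "balanced_lift K P r A N l T b \<in> extensional (carrier ?B)" by auto
qed

lemma balanced_linear_param:
  assumes S: "module K S" and T: "module K T"
    and g: "\<And>s. s \<in> carrier S \<Longrightarrow> g s \<in> linear_maps K (balanced_tensor_space K P r A N l) T"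
    and gen: "\<And>p n. p \<in> carrier P \<Longrightarrow> n \<in> carrier N \<Longrightarrow>
      (\<lambda>s. g s (balanced_tens K P r A N l p n)) \<in> linear_maps K S T"
    and x: "x \<in> carrier (balanced_tensor_space K P r A N l)"
  shows "(\<lambda>s. g s x) \<in> linear_maps K S T"
  using x
proof (rule balanced_induct)
  let ?B = "balanced_tensor_space K P r A N l"
  show "(\<lambda>s. g s (x \<oplus>\<^bsub>?B\<^esub> y)) \<in> linear_maps K S T"
    if "x \<in> carrier ?B" "y \<in> carrier ?B"
      "(\<lambda>s. g s x) \<in> linear_maps K S T" "(\<lambda>s. g s y) \<in> linear_maps K S T" for x y
    by (rule linear_maps_cong[OF linear_maps_pointwise_add[OF T that(3,4)] S])
       (simp add: linear_maps_add[OF g that(1,2)])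
  show "(\<lambda>s. g s (a \<odot>\<^bsub>?B\<^esub> x)) \<in> linear_maps K S T"
    if "a \<in> carrier K" "x \<in> carrier ?B" "(\<lambda>s. g s x) \<in> linear_maps K S T" for a x
    by (rule linear_maps_cong[OF linear_maps_pointwise_smult[OF T that(3,1)] S])
       (simp add: linear_maps_smult[OF g that(1,2)])
qed (rule gen)

end

section \<open>Comodules in Sweedler notation\<close>

lemma hom_algebra_module: "hom_algebra K A \<Longrightarrow> module K A"
  by (simp add: hom_algebra_def hom_module_def)

context right_hom_comodule
begin

text \<open>
  Coassociativity in the form in which it is used inside computations: both sides of the axiom are
  fed to the linear map on \<open>M \<otimes> (C \<otimes> C)\<close> induced by the trilinear map \<open>t\<close>.
\<close>

lemma coassoc_sweedler:
  fixes T :: "('k, 'tt, 'zz) module_scheme"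
  assumes T: "module K T"
    and t1: "\<And>c d. c \<in> carrier C \<Longrightarrow> d \<in> carrier C \<Longrightarrow> (\<lambda>m. t m c d) \<in> linear_maps K M T"
    and t2: "\<And>m d. m \<in> carrier M \<Longrightarrow> d \<in> carrier C \<Longrightarrow> (\<lambda>c. t m c d) \<in> linear_maps K C T"
    and t3: "\<And>m c. m \<in> carrier M \<Longrightarrow> c \<in> carrier C \<Longrightarrow> t m c \<in> linear_maps K C T"
    and m: "m \<in> carrier M"
  shows "tensor_lift K M C T
      (\<lambda>m0 c. tensor_lift K M C T (\<lambda>n d. t n d (twist C c)) (coact m0)) (coact m) =
    tensor_lift K M C T
      (\<lambda>m0 c. tensor_lift K C C T (\<lambda>c1 c2. t (twist M m0) c1 c2) (comult C c)) (coact m)"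
proof -
  note [simp] = M.module_axioms C.module_axioms T tensor_space_module
  note [simp] = t1 t2 t3
  note lins = coact_linear C.comult_linear C.twist_linear M.twist_linear
  note [simp] = lins[THEN linear_maps_closed] linear_maps_comp[OF _ lins(1)]
     linear_maps_comp[OF _ lins(2)] linear_maps_comp[OF _ lins(3)] linear_maps_comp[OF _ lins(4)]
  let ?CC = "tensor_space K C C" and ?MC = "tensor_space K M C"
  let ?L = "tensor_lift K M ?CC T (\<lambda>u s. tensor_lift K C C T (t u) s)"
  let ?G = "\<lambda>z. ?L (tensor_assoc K M C C z)"
  \<comment> \<open>\<open>?L\<close> evaluates \<open>t\<close> on \<open>M \<otimes> (C \<otimes> C)\<close>, and \<open>?G\<close> evaluates it on \<open>(M \<otimes> C) \<otimes> C\<close>.\<close>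
  have L: "(\<lambda>u s. tensor_lift K C C T (t u) s) \<in> bilinear_maps K M ?CC T"
    by (simp add: lin_rules)
  have Ll: "?L \<in> linear_maps K (tensor_space K M ?CC) T" by (simp add: tensor_lift_linear L)
  have G: "?G \<in> linear_maps K (tensor_space K ?MC C) T"
    by (rule linear_maps_comp[OF tensor_assoc_linear Ll]) simp_all
  have Gt: "?G (tens K ?MC C s d) = tensor_lift K M C T (\<lambda>n c. t n c d) s"
    if s: "s \<in> carrier ?MC" and d: "d \<in> carrier C" for s d
  proof -
    have "?G (tens K ?MC C s d) = tensor_lift K M C T (\<lambda>u v. ?L (tens K M ?CC u (tens K C C v d))) s"
      using s d by (simp add: tensor_assoc_tens)
       (rule linear_tensor_lift[OF _ _ _ _ Ll]; simp add: lin_rules)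
    also have "\<dots> = tensor_lift K M C T (\<lambda>n c. t n c d) s"
      by (rule tensor_lift_arg_cong) (use d in \<open>simp add: tensor_lift_tens L tens_closed lin_rules\<close>)
    finally show ?thesis .
  qed
  have "?G (tensor_map K M C ?MC C coact (twist C) (coact m)) =
      tensor_lift K ?MC C T (\<lambda>s d. ?G (tens K ?MC C s d)) (tensor_map K M C ?MC C coact (twist C) (coact m))"
    by (rule linear_as_tensor_lift)
       (use m G in \<open>simp_all add: lins linear_maps_closed[OF tensor_map_linear]\<close>)
  also have "\<dots> = tensor_lift K ?MC C T (\<lambda>s d. tensor_lift K M C T (\<lambda>n c. t n c d) s)
      (tensor_map K M C ?MC C coact (twist C) (coact m))"
    by (rule tensor_lift_arg_cong) (rule Gt)
  also have "\<dots> = tensor_lift K M C T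
      (\<lambda>m0 c. tensor_lift K M C T (\<lambda>n d. t n d (twist C c)) (coact m0)) (coact m)"
    by (rule tensor_lift_tensor_map) (use m lins in \<open>simp_all add: lin_rules\<close>)
  finally have 1: "?G (tensor_map K M C ?MC C coact (twist C) (coact m)) = \<dots>" .
  have 2: "?L (tensor_map K M C M ?CC (twist M) (comult C) (coact m)) = tensor_lift K M C T
      (\<lambda>m0 c. tensor_lift K C C T (\<lambda>c1 c2. t (twist M m0) c1 c2) (comult C c)) (coact m)"
    by (rule tensor_lift_tensor_map) (use m lins L in \<open>simp_all add: lin_rules\<close>)
  show ?thesis using 1 2 coact_coact[OF m] by simp
qed

end

lemma (in right_hom_comodule) lift_coact_twist:
  assumes "module K T" "b \<in> bilinear_maps K M C T" "m \<in> carrier M"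
  shows "tensor_lift K M C T b (coact (twist M m)) =
    tensor_lift K M C T (\<lambda>m0 c. b (twist M m0) (twist C c)) (coact m)"
  unfolding twist_coact[OF assms(3), symmetric]
  by (rule tensor_lift_tensor_map)
     (use assms M.module_axioms C.module_axioms in \<open>auto intro: M.twist_linear C.twist_linear linear_maps_closed[OF coact_linear]\<close>)

lemma (in comodule_algebra) lift_alg_coact_mult:
  assumes H: "hom_algebra K H" and T: "module K T" and b: "b \<in> bilinear_maps K A H T"
    and xy: "x \<in> carrier A" "y \<in> carrier A"
  shows "tensor_lift K A H T b (alg_coact A (x \<otimes>\<^bsub>A\<^esub> y)) =
    tensor_lift K A H T (\<lambda>x0 x1. tensor_lift K A H T (\<lambda>y0 y1. b (x0 \<otimes>\<^bsub>A\<^esub> y0) (x1 \<otimes>\<^bsub>H\<^esub> y1)) (alg_coact A y))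
      (alg_coact A x)"
  unfolding alg_coact_mult[OF xy] 
  by (simp add: tensor_hom_algebra_def Let_def, rule tensor_lift_tensor_bimap)
     (use T b xy H module_axioms hom_algebra_module in
      \<open>auto intro: mult_bilinear hom_algebra.mult_bilinear linear_maps_closed[OF coact_linear]\<close>)

lemma (in doi_hopf_module) lift_coact_act:
  assumes T: "module K T" and b: "b \<in> bilinear_maps K M C T"
    and am: "a \<in> carrier A" "m \<in> carrier M"
  shows "tensor_lift K M C T b (coact M (act M a m)) =
    tensor_lift K A H T (\<lambda>a0 a1. tensor_lift K M C T (\<lambda>m0 m1. b (act M a0 m0) (coalg_act C a1 m1)) (coact M m))
      (alg_coact A a)"
  unfolding coact_act[OF am]
  by (rule tensor_lift_tensor_bimap)
     (use T b am in \<open>auto intro: L.act_bilinear D.C.act_bilinear L.M.module_axioms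
        D.A.module_axioms D.H.module_axioms D.C.module_axioms
        linear_maps_closed[OF R.coact_linear] linear_maps_closed[OF D.A.coact_linear]\<close>)

context hom_module
begin

abbreviation untwist where "untwist \<equiv> inv_into (carrier V) (twist V)"

lemma twist_untwist: "x \<in> carrier V \<Longrightarrow> twist V (untwist x) = x"
  and untwist_twist: "x \<in> carrier V \<Longrightarrow> untwist (twist V x) = x"
  using twist_bij by (auto simp: bij_betw_def f_inv_into_f)

lemma untwist_closed: "x \<in> carrier V \<Longrightarrow> untwist x \<in> carrier V"
  using twist_bij by (auto simp: bij_betw_def inv_into_into)

lemma untwist_eqI: "y \<in> carrier V \<Longrightarrow> x = twist V y \<Longrightarrow> untwist x = y"
  by (simp add: untwist_twist)

lemma untwist_linear: "untwist \<in> linear_maps K V V"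
proof (rule linear_mapsI)
  fix x y assume "x \<in> carrier V" "y \<in> carrier V"
  then show "untwist (x \<oplus>\<^bsub>V\<^esub> y) = untwist x \<oplus>\<^bsub>V\<^esub> untwist y"
    by (intro untwist_eqI)
       (simp_all add: untwist_closed twist_untwist linear_maps_add[OF twist_linear])
next
  fix a x assume "a \<in> carrier K" "x \<in> carrier V"
  then show "untwist (a \<odot>\<^bsub>V\<^esub> x) = a \<odot>\<^bsub>V\<^esub> untwist x"
    by (intro untwist_eqI)
       (simp_all add: untwist_closed twist_untwist linear_maps_smult[OF twist_linear])
qed (rule untwist_closed)

end

context hom_coalgebra
begin

lemma counit_untwist: "c \<in> carrier C \<Longrightarrow> counit C (untwist c) = counit C c"
  using counit_twist[OF untwist_closed] by (simp add: twist_untwist)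

text \<open>
  The tensor square of the inverse twist is inverse to that of the twist, with which
  the comultiplication commutes.
\<close>

lemma comult_untwist:
  assumes c: "c \<in> carrier C"
  shows "comult C (untwist c) = tensor_map K C C C C untwist untwist (comult C c)"
proof -
  note m = module_axioms
  let ?CC = "tensor_space K C C"
  let ?u = "tensor_map K C C C C untwist untwist" and ?t = "tensor_map K C C C C (twist C) (twist C)"
  have ul: "?u \<in> linear_maps K ?CC ?CC" and tl: "?t \<in> linear_maps K ?CC ?CC"
    by (intro tensor_map_linear m untwist_linear twist_linear)+
  have "?u (?t x) = x" if "x \<in> carrier ?CC" for x
    by (rule tensor_linear_ext[OF m m linear_maps_comp[OF tl ul] lin_id _ that])
       (simp add: tensor_map_tens m untwist_linear twist_linear linear_maps_closed[OF twist_linear] untwist_twist)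
  from this[OF linear_maps_closed[OF comult_linear untwist_closed[OF c]]]
  show ?thesis using comult_twist[OF untwist_closed[OF c]] by (simp add: twist_untwist c)
qed

end

lemma smult_bilinear:
  assumes "module K V" shows "smult V \<in> bilinear_maps K (ground_hom_algebra K) V V"
proof -
  interpret V: module K V by fact
  show ?thesis
    by (intro bilinear_mapsI linear_mapsI)
       (simp_all add: ground_hom_algebra_def V.smult_l_distr V.smult_r_distr
          V.smult_assoc1[symmetric] V.R.m_comm)
qed

section \<open>The induced coaction\<close>

text \<open>
  The map \<open>(h, d) \<mapsto> \<alpha>\<^sup>-\<^sup>2(h \<cdot> \<gamma>(d))\<close>, which produces the \<open>C\<close>-component of the induced coaction.
\<close>

definition untwisted_act ::
    "('k, 'c, 'h, 't) module_coalgebra_scheme \<Rightarrow> ('d \<Rightarrow> 'c) \<Rightarrow> 'h \<Rightarrow> 'd \<Rightarrow> 'c"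
  where "untwisted_act C \<gamma> h d = (inv_into (carrier C) (twist C) ^^ 2) (coalg_act C h (\<gamma> d))"

locale doi_hopf_induction =
  X: doi_hopf_datum_morphism K H A C H' A' C' \<theta> \<beta> \<gamma> + M: doi_hopf_module K H A C M
  for K :: "('k, 'r) ring_scheme"
    and H :: "('k, 'h, 's) hom_hopf_algebra_scheme"
    and A :: "('k, 'a, 'h, 't) comodule_algebra_scheme"
    and C :: "('k, 'c, 'h, 'u) module_coalgebra_scheme"
    and H' :: "('k, 'h', 's') hom_hopf_algebra_scheme"
    and A' :: "('k, 'a', 'h', 't') comodule_algebra_scheme"
    and C' :: "('k, 'c', 'h', 'u') module_coalgebra_scheme"
    and \<theta> :: "'h \<Rightarrow> 'h'" and \<beta> :: "'a \<Rightarrow> 'a'" and \<gamma> :: "'c \<Rightarrow> 'c'"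
    and M :: "('k, 'm, 'a, 'c) doi_hopf_module"
begin

abbreviation "\<kappa> \<equiv> untwisted_act C' \<gamma>"

lemma datum_modules [simp]: "module K H" "module K A" "module K C" "module K M"
    "module K H'" "module K A'" "module K C'"
  by (fact X.S.H.module_axioms X.S.A.module_axioms X.S.C.module_axioms M.L.M.module_axioms
        X.T.H.module_axioms X.T.A.module_axioms X.T.C.module_axioms)+

lemma maps: "\<theta> \<in> linear_maps K H H'" "\<beta> \<in> linear_maps K A A'" "\<gamma> \<in> linear_maps K C C'"
  using X.hopf_map X.algebra_map X.coalgebra_map
  by (auto simp: hom_hopf_algebra_map_def hom_algebra_map_def hom_coalgebra_map_def)

lemmas lins = maps X.T.H.twist_linear X.T.A.twist_linear X.T.C.twist_linear X.T.C.untwist_linear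
  M.L.M.twist_linear X.S.C.twist_linear X.S.A.twist_linear X.S.H.twist_linear
  X.T.A.coact_linear X.S.A.coact_linear M.R.coact_linear
  X.T.H.comult_linear X.T.C.comult_linear X.S.C.comult_linear

lemmas bils = X.T.A.mult_bilinear X.T.H.mult_bilinear M.L.act_bilinear
  X.T.C.act_bilinear X.S.C.act_bilinear

lemmas [simp] = lins lins[THEN linear_maps_closed] lins[THEN lin_comp]
  bils bils[THEN bilinear_maps_closed] bils[THEN bilin_left] bils[THEN bilin_right]
declare lin_rules [simp]

lemma \<kappa>_eq: "\<kappa> h c = X.T.C.untwist (X.T.C.untwist (coalg_act C' h (\<gamma> c)))"
  by (simp add: untwisted_act_def numeral_2_eq_2)

lemma twist_twist_\<kappa>: "h \<in> carrier H' \<Longrightarrow> c \<in> carrier C \<Longrightarrow>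
    twist C' (twist C' (\<kappa> h c)) = coalg_act C' h (\<gamma> c)"
  by (simp add: \<kappa>_eq X.T.C.twist_untwist)

lemma \<kappa>_bilinear: "\<kappa> \<in> bilinear_maps K H' C C'"
  by (simp add: \<kappa>_eq[abs_def])

lemmas [simp] = \<kappa>_bilinear \<kappa>_bilinear[THEN bilinear_maps_closed] \<kappa>_bilinear[THEN bilin_left]
  \<kappa>_bilinear[THEN bilin_right]

lemma \<gamma>_twist: "c \<in> carrier C \<Longrightarrow> \<gamma> (twist C c) = twist C' (\<gamma> c)"
  using X.coalgebra_map by (auto simp: hom_coalgebra_map_def)

text \<open>
  Since the twist is injective, an identity for \<open>\<kappa>\<close> may be checked after two twists, where no inverse
  is left.
\<close>

lemma \<kappa>_eqI: "x \<in> carrier C' \<Longrightarrow> twist C' (twist C' x) = coalg_act C' h (\<gamma> c) \<Longrightarrow> \<kappa> h c = x"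
  by (metis \<kappa>_eq X.T.C.untwist_twist X.T.C.twist_linear linear_maps_closed)

lemma \<kappa>_twist: "h \<in> carrier H' \<Longrightarrow> c \<in> carrier C \<Longrightarrow> \<kappa> (twist H' h) (twist C c) = twist C' (\<kappa> h c)"
  by (rule \<kappa>_eqI) (simp_all add: twist_twist_\<kappa> \<gamma>_twist X.T.C.twist_act)

lemma \<kappa>_counit: "h \<in> carrier H' \<Longrightarrow> c \<in> carrier C \<Longrightarrow>
    counit C' (\<kappa> h c) = counit H' h \<otimes>\<^bsub>K\<^esub> counit C c"
  using X.coalgebra_map
  by (simp add: \<kappa>_eq X.T.C.counit_untwist X.T.C.counit_coalg_act hom_coalgebra_map_def)

text \<open>
  Hom-associativity of the action gives \<open>(\<alpha>(h) g) \<cdot> \<alpha>(\<gamma>(c)) = \<alpha>\<^sup>2(h) \<cdot> (g \<cdot> \<gamma>(c))\<close>, which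
  is \<open>\<alpha>\<^sup>2\<close> of \<open>h \<cdot> \<kappa>(g, c)\<close>.
\<close>

lemma \<kappa>_mult:
  assumes "h \<in> carrier H'" "g \<in> carrier H'" "c \<in> carrier C"
  shows "\<kappa> (twist H' h \<otimes>\<^bsub>H'\<^esub> g) (twist C c) = coalg_act C' h (\<kappa> g c)"
  by (rule \<kappa>_eqI)
     (use assms in \<open>simp_all add: twist_twist_\<kappa> \<gamma>_twist X.T.C.twist_act X.T.C.act_act[symmetric]\<close>)

text \<open>
  After \<open>\<alpha>\<^sup>2\<close> both sides are \<open>\<alpha>(g) \<cdot> (\<theta>(h) \<cdot> \<gamma>(c))\<close>.
\<close>

lemma \<kappa>_balanced:
  assumes "g \<in> carrier H'" "h \<in> carrier H" "c \<in> carrier C"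
  shows "\<kappa> (g \<otimes>\<^bsub>H'\<^esub> \<theta> h) (twist C c) = \<kappa> (twist H' g) (coalg_act C h c)"
  using assms by (simp add: \<kappa>_eq \<gamma>_twist X.coalg_act_map X.T.C.act_act)

text \<open>
  The comultiplication is multiplicative for the action of \<open>H'\<close> on \<open>C'\<close>, and it commutes with \<open>\<gamma>\<close>
  and with the inverse twist.
\<close>

lemma \<kappa>_comult:
  assumes h: "h \<in> carrier H'" and c: "c \<in> carrier C"
  shows "comult C' (\<kappa> h c) = tensor_lift K H' H' (tensor_space K C' C')
    (\<lambda>h1 h2. tensor_lift K C C (tensor_space K C' C') (\<lambda>c1 c2. tens K C' C' (\<kappa> h1 c1) (\<kappa> h2 c2)) (comult C c))
    (comult H' h)"
proof -
  let ?CC = "tensor_space K C' C'" and ?u = X.T.C.untwist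
  note lin' [simp] = tensor_map_linear[THEN linear_maps_closed]
  let ?y = "comult C' (coalg_act C' h (\<gamma> c))"
  have y: "?y = tensor_bimap K H' H' C' C' C' C' (coalg_act C') (coalg_act C') (comult H' h)
      (tensor_map K C C C' C' \<gamma> \<gamma> (comult C c))"
    using X.T.C.comult_coalg_act[OF h, of "\<gamma> c"] X.coalgebra_map c by (simp add: hom_coalgebra_map_def)
  have "comult C' (\<kappa> h c) = tensor_map K C' C' C' C' ?u ?u (tensor_map K C' C' C' C' ?u ?u ?y)"
    using h c by (simp add: \<kappa>_eq X.T.C.comult_untwist)
  also have "\<dots> = tensor_lift K C' C' ?CC (tens K C' C') \<dots>"
    using h c by (subst tensor_lift_id) simp_all
  also have "\<dots> = tensor_lift K C' C' ?CC (\<lambda>a b. tens K C' C' (?u (?u a)) (?u (?u b))) ?y"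
    using h c by (simp add: tensor_lift_tensor_map)
  also have "\<dots> = tensor_lift K H' H' ?CC
    (\<lambda>h1 h2. tensor_lift K C C ?CC (\<lambda>c1 c2. tens K C' C' (\<kappa> h1 c1) (\<kappa> h2 c2)) (comult C c))
    (comult H' h)"
    unfolding y using h c
    by (simp add: tensor_lift_tensor_bimap tensor_lift_tensor_map \<kappa>_eq cong: tensor_lift_sweedler_cong)
  finally show ?thesis .
qed

end

definition induced_coact ::
    "('k, 'r) ring_scheme \<Rightarrow> ('k, 'a, 's) hom_module_scheme \<Rightarrow> ('k, 'h', 's') hom_module_scheme \<Rightarrow>
     ('k, 'a', 'h', 't') comodule_algebra_scheme \<Rightarrow> ('k, 'c, 'u) module_scheme \<Rightarrow>
     ('k, 'c', 'h', 'u') module_coalgebra_scheme \<Rightarrow> ('a \<Rightarrow> 'a') \<Rightarrow> ('c \<Rightarrow> 'c') \<Rightarrow>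
     ('k, 'm, 'a, 'c) doi_hopf_module \<Rightarrow> 'a' \<Rightarrow> 'm \<Rightarrow> ('k, ('k, 'a', 'm) tensor set, 'c') tensor"
  where "induced_coact K A H' A' C C' \<beta> \<gamma> M b m =
    (let I = induced_space K A A' \<beta> M; T = tensor_space K I C' in
      tensor_lift K A' H' T (\<lambda>b0 b1. tensor_lift K M C T
        (\<lambda>m0 m1. tens K I C' (induced_tens K A A' \<beta> M b0 m0) (untwisted_act C' \<gamma> b1 m1))
        (coact M m)) (alg_coact A' b))"

definition induced_lift ::
    "('k, 'r) ring_scheme \<Rightarrow> ('k, 'a, 's) hom_module_scheme \<Rightarrow> ('k, 'b, 't) hom_module_scheme \<Rightarrow>
     ('a \<Rightarrow> 'b) \<Rightarrow> ('k, 'm, 'a, 'c) doi_hopf_module \<Rightarrow> ('k, 'u, 'w) module_scheme \<Rightarrow>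
     ('b \<Rightarrow> 'm \<Rightarrow> 'u) \<Rightarrow> ('k, 'b, 'm) tensor set \<Rightarrow> 'u"
  where "induced_lift K A A' \<beta> M = balanced_lift K A' (\<lambda>b' a. b' \<otimes>\<^bsub>A'\<^esub> \<beta> a) A M (act M)"

text \<open>
  The meaningless fields \<open>mult\<close> and \<open>one\<close> are copied from the underlying space, so that truncating the
  record returns \<open>induced_space\<close> itself.
\<close>

definition induced_module ::
    "('k, 'r) ring_scheme \<Rightarrow> ('k, 'a, 's) hom_module_scheme \<Rightarrow> ('k, 'h', 's') hom_module_scheme \<Rightarrow>
     ('k, 'a', 'h', 't') comodule_algebra_scheme \<Rightarrow> ('k, 'c, 'u) module_scheme \<Rightarrow>
     ('k, 'c', 'h', 'u') module_coalgebra_scheme \<Rightarrow> ('a \<Rightarrow> 'a') \<Rightarrow> ('c \<Rightarrow> 'c') \<Rightarrow>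
     ('k, 'm, 'a, 'c) doi_hopf_module \<Rightarrow> ('k, ('k, 'a', 'm) tensor set, 'a', 'c') doi_hopf_module"
  where "induced_module K A H' A' C C' \<beta> \<gamma> M =
    (let I = induced_space K A A' \<beta> M; e = induced_tens K A A' \<beta> M in
    \<lparr>carrier = carrier I, mult = mult I, one = one I, zero = zero I, add = add I, smult = smult I,
     twist = induced_lift K A A' \<beta> M I (\<lambda>b m. e (twist A' b) (twist M m)),
     act = (\<lambda>a'. induced_lift K A A' \<beta> M I (\<lambda>b m. e (twist A' a' \<otimes>\<^bsub>A'\<^esub> b) (twist M m))),
     coact = induced_lift K A A' \<beta> M (tensor_space K I C') (induced_coact K A H' A' C C' \<beta> \<gamma> M)\<rparr>)"

context doi_hopf_induction
begin

abbreviation "I \<equiv> induced_space K A A' \<beta> M"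
abbreviation "e \<equiv> induced_tens K A A' \<beta> M"
abbreviation "IC \<equiv> tensor_space K I C'"

lemma induced_space_module [simp]: "module K I"
  unfolding induced_space_def by (rule balanced_tensor_space_module) simp_all

lemma e_bilinear: "e \<in> bilinear_maps K A' M I"
  unfolding induced_space_def induced_tens_def by (rule balanced_tens_bilinear) simp_all

lemmas [simp] = e_bilinear e_bilinear[THEN bilinear_maps_closed] e_bilinear[THEN bilin_left]
  e_bilinear[THEN bilin_right]

lemma e_balanced: "b \<in> carrier A' \<Longrightarrow> a \<in> carrier A \<Longrightarrow> m \<in> carrier M \<Longrightarrow>
    e (b \<otimes>\<^bsub>A'\<^esub> \<beta> a) (twist M m) = e (twist A' b) (act M a m)"
  unfolding induced_tens_def by (rule balanced_tens_balanced) simp_all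

lemma induced_ext:
  assumes "f \<in> linear_maps K I T" "g \<in> linear_maps K I T"
    and "\<And>b m. b \<in> carrier A' \<Longrightarrow> m \<in> carrier M \<Longrightarrow> f (e b m) = g (e b m)" and "x \<in> carrier I"
  shows "f x = g x"
  by (rule balanced_linear_ext[where K = K and P = A' and N = M and A = A and l = "act M" and r = "\<lambda>b' a. b' \<otimes>\<^bsub>A'\<^esub> \<beta> a"])
     (use assms in \<open>simp_all add: induced_space_def induced_tens_def\<close>)

lemma induced_lift_props:
  assumes "module K T" "b \<in> bilinear_maps K A' M T"
    and "\<And>p a n. p \<in> carrier A' \<Longrightarrow> a \<in> carrier A \<Longrightarrow> n \<in> carrier M \<Longrightarrow>
      b (p \<otimes>\<^bsub>A'\<^esub> \<beta> a) (twist M n) = b (twist A' p) (act M a n)"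
  shows induced_lift_linear: "induced_lift K A A' \<beta> M T b \<in> linear_maps K I T"
    and induced_lift_tens: "p \<in> carrier A' \<Longrightarrow> n \<in> carrier M \<Longrightarrow>
      induced_lift K A A' \<beta> M T b (e p n) = b p n"
    and induced_lift_extensional: "induced_lift K A A' \<beta> M T b \<in> extensional (carrier I)"
  unfolding induced_lift_def induced_space_def induced_tens_def
  by (rule balanced_lift_linear balanced_lift_tens balanced_lift_extensional; use assms in simp)+

lemma induced_linear_param:
  assumes "module K S" "module K T" "\<And>s. s \<in> carrier S \<Longrightarrow> g s \<in> linear_maps K I T"
    and "\<And>p n. p \<in> carrier A' \<Longrightarrow> n \<in> carrier M \<Longrightarrow> (\<lambda>s. g s (e p n)) \<in> linear_maps K S T"
    and "x \<in> carrier I"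
  shows "(\<lambda>s. g s x) \<in> linear_maps K S T"
  by (rule balanced_linear_param[where K = K and P = A' and N = M and A = A and l = "act M" and r = "\<lambda>b' a. b' \<otimes>\<^bsub>A'\<^esub> \<beta> a"])
     (use assms in \<open>simp_all add: induced_space_def induced_tens_def\<close>)

abbreviation "coa \<equiv> induced_coact K A H' A' C C' \<beta> \<gamma> M"

lemma coa_eq: "coa b m = tensor_lift K A' H' IC (\<lambda>b0 b1. tensor_lift K M C IC
    (\<lambda>m0 m1. tens K I C' (e b0 m0) (\<kappa> b1 m1)) (coact M m)) (alg_coact A' b)"
  by (simp add: induced_coact_def Let_def)

lemma coa_bilinear: "coa \<in> bilinear_maps K A' M IC"
  by (simp add: coa_eq[abs_def])

lemmas [simp] = coa_bilinear coa_bilinear[THEN bilinear_maps_closed]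

text \<open>
  Every axiom about the coaction starts here: a linear map applied to \<open>\<rho>(b \<otimes> m)\<close> becomes a double
  Sweedler sum.
\<close>

lemma linear_coa:
  assumes "module K T" "g \<in> linear_maps K IC T" "b \<in> carrier A'" "m \<in> carrier M"
  shows "g (coa b m) = tensor_lift K A' H' T (\<lambda>b0 b1. tensor_lift K M C T
    (\<lambda>m0 m1. g (tens K I C' (e b0 m0) (\<kappa> b1 m1))) (coact M m)) (alg_coact A' b)"
  unfolding coa_eq using assms
  by (simp add: linear_tensor_lift[OF _ _ _ assms(1,2)] cong: tensor_lift_sweedler_cong)

lemma lift_alg_coact_\<beta>:
  assumes "module K T" "f \<in> bilinear_maps K A' H' T" "a \<in> carrier A"
  shows "tensor_lift K A' H' T f (alg_coact A' (\<beta> a)) =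
    tensor_lift K A H T (\<lambda>a0 a1. f (\<beta> a0) (\<theta> a1)) (alg_coact A a)"
  using assms by (simp add: X.alg_coact_map tensor_lift_tensor_map)

text \<open>
  Both sides are the triple sum of \<open>e(b\<^sub>0 \<beta>(a\<^sub>0), \<alpha>(m\<^sub>0)) \<otimes> \<kappa>(b\<^sub>1 \<theta>(a\<^sub>1), \<alpha>(m\<^sub>1))\<close>. On the right, where
  the sum is over \<open>e(\<alpha>(b\<^sub>0), a\<^sub>0 \<cdot> m\<^sub>0) \<otimes> \<kappa>(\<alpha>(b\<^sub>1), a\<^sub>1 \<cdot> m\<^sub>1)\<close>, the balancing relation
  of \<open>A' \<otimes>\<^sub>A M\<close> is applied in the first tensor factor and \<open>\<kappa>_balanced\<close> in the second.
\<close>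

lemma coa_balanced:
  assumes b: "b \<in> carrier A'" and a: "a \<in> carrier A" and m: "m \<in> carrier M"
  shows "coa (b \<otimes>\<^bsub>A'\<^esub> \<beta> a) (twist M m) = coa (twist A' b) (act M a m)"
  unfolding coa_eq using assms
  by (simp add: X.T.A.lift_alg_coact_mult[OF X.T.H.hom_algebra_axioms] lift_alg_coact_\<beta>
    M.R.lift_coact_twist X.T.A.lift_coact_twist M.lift_coact_act \<kappa>_balanced e_balanced cong: tensor_lift_sweedler_cong)

end

section \<open>The induced Doi-Hopf module\<close>

text \<open>
  The induced module \<open>J\<close> is a record extending \<open>induced_space\<close>. Spaces of linear maps and tensor products
  depend only on the carrier, the addition and the scalar multiplication, so the two records are
  interchangeable in them; oriented as rewrite rules, these equations remove the larger record.
\<close>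

context
  fixes V :: "('k, 'v, 's) module_scheme" and V' :: "('k, 'v, 's') module_scheme"
  assumes c: "carrier V = carrier V'" and a: "add V = add V'" and s: "smult V = smult V'"
begin

lemma linear_maps_transfer: "linear_maps K V = linear_maps K V'" "linear_maps K W V = linear_maps K W V'"
  by (simp_all add: linear_maps_def c a s fun_eq_iff)

lemma tensor_space_transfer: "tensor_space K V W = tensor_space K V' W"
  by (simp add: tensor_space_def tensor_null_def tensor_relations_def Let_def c a s)

lemma tens_transfer: "tens K V W = tens K V' W"
  by (simp add: tens_def tensor_null_def tensor_relations_def Let_def c a s fun_eq_iff)

lemma tensor_lift_transfer: "tensor_lift K V W = tensor_lift K V' W"
    "tensor_lift K X W V = tensor_lift K X W V'"
  by (simp_all add: tensor_lift_def linear_maps_transfer tensor_space_transfer tens_transfer c fun_eq_iff)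

lemmas basic_transfer = linear_maps_transfer tensor_space_transfer tens_transfer tensor_lift_transfer

lemma tensor_map_transfer: "tensor_map K V W = tensor_map K V' W"
   "tensor_map K X W V Y = tensor_map K X W V' Y"
  by (simp_all add: tensor_map_def basic_transfer fun_eq_iff)

lemma tensor_assoc_transfer: "tensor_assoc K V W X = tensor_assoc K V' W X"
  by (simp add: tensor_assoc_def basic_transfer)

lemma tensor_bimap_transfer: "tensor_bimap K X W V Y Z U = tensor_bimap K X W V' Y Z U"
    "tensor_bimap K X W Z Y V U = tensor_bimap K X W Z Y V' U"
  by (simp_all add: tensor_bimap_def basic_transfer tensor_map_transfer fun_eq_iff)

lemma bilinear_maps_transfer: "bilinear_maps K X V U = bilinear_maps K X V' U"
    "bilinear_maps K X W V = bilinear_maps K X W V'"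
  by (simp_all add: bilinear_maps_def linear_maps_transfer c)

lemma module_transfer:
  assumes z: "zero V = zero V'" and m: "module K V'"
  shows "module K V"
proof -
  interpret V': module K V' by (rule m)
  show ?thesis
  proof (intro moduleI abelian_groupI)
    show "\<exists>y\<in>carrier V. y \<oplus>\<^bsub>V\<^esub> x = \<zero>\<^bsub>V\<^esub>" if "x \<in> carrier V" for x
      using that V'.l_neg by (auto simp: c a z)
  qed (simp_all add: c a s z V'.a_ac V'.smult_l_distr V'.smult_r_distr V'.smult_assoc1 V'.R.is_cring)
qed

lemmas module_scheme_transfer = basic_transfer tensor_map_transfer tensor_assoc_transfer
  tensor_bimap_transfer bilinear_maps_transfer

end

context doi_hopf_induction
begin

abbreviation "J \<equiv> induced_module K A H' A' C C' \<beta> \<gamma> M"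

lemma J_simps [simp]: "carrier J = carrier I" "add J = add I" "smult J = smult I" "zero J = zero I"
  by (simp_all add: induced_module_def Let_def)

lemmas J_transfer [simp] = module_scheme_transfer[OF J_simps(1-3)]

lemma J_module [simp]: "module K J"
  by (rule module_transfer[OF J_simps]) simp

lemma twist_J: "twist J = induced_lift K A A' \<beta> M I (\<lambda>b m. e (twist A' b) (twist M m))"
  and act_J: "act J a' = induced_lift K A A' \<beta> M I (\<lambda>b m. e (twist A' a' \<otimes>\<^bsub>A'\<^esub> b) (twist M m))"
  and coact_J: "coact J = induced_lift K A A' \<beta> M IC coa"
  by (simp_all add: induced_module_def Let_def)

lemma \<beta>_twist: "a \<in> carrier A \<Longrightarrow> \<beta> (twist A a) = twist A' (\<beta> a)"
  using X.algebra_map by (auto simp: hom_algebra_map_def)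

lemma twist_J_balanced:
  assumes "b \<in> carrier A'" "a \<in> carrier A" "m \<in> carrier M"
  shows "e (twist A' (b \<otimes>\<^bsub>A'\<^esub> \<beta> a)) (twist M (twist M m)) = e (twist A' (twist A' b)) (twist M (act M a m))"
  using e_balanced[of "twist A' b" "twist A a" "twist M m"] assms
  by (simp add: X.T.A.twist_mult M.L.twist_act \<beta>_twist)

text \<open>
  Hom-associativity turns \<open>\<alpha>(a') (b \<beta>(a))\<close> into \<open>(a' b) \<alpha>(\<beta>(a))\<close>, so the relation for
  \<open>(b, a, m)\<close> goes to the relation for \<open>(a' b, \<alpha>(a), \<alpha>(m))\<close>.
\<close>

lemma act_J_balanced:
  assumes "a' \<in> carrier A'" "b \<in> carrier A'" "a \<in> carrier A" "m \<in> carrier M"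
  shows "e (twist A' a' \<otimes>\<^bsub>A'\<^esub> (b \<otimes>\<^bsub>A'\<^esub> \<beta> a)) (twist M (twist M m)) =
    e (twist A' a' \<otimes>\<^bsub>A'\<^esub> twist A' b) (twist M (act M a m))"
  using e_balanced[of "a' \<otimes>\<^bsub>A'\<^esub> b" "twist A a" "twist M m"] assms
  by (simp add: X.T.A.twist_mult M.L.twist_act \<beta>_twist X.T.A.hom_assoc)

lemma twist_J_linear: "twist J \<in> linear_maps K I I"
  and twist_J_tens: "b \<in> carrier A' \<Longrightarrow> m \<in> carrier M \<Longrightarrow> twist J (e b m) = e (twist A' b) (twist M m)"
  unfolding twist_J
  by (rule induced_lift_linear induced_lift_tens; simp add: twist_J_balanced)+

lemma act_J_linear: "a' \<in> carrier A' \<Longrightarrow> act J a' \<in> linear_maps K I I"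
  and act_J_tens: "a' \<in> carrier A' \<Longrightarrow> b \<in> carrier A' \<Longrightarrow> m \<in> carrier M \<Longrightarrow>
    act J a' (e b m) = e (twist A' a' \<otimes>\<^bsub>A'\<^esub> b) (twist M m)"
  unfolding act_J
  by (rule induced_lift_linear induced_lift_tens; simp add: act_J_balanced)+

lemma act_J_bilinear: "act J \<in> bilinear_maps K A' I I"
proof (rule bilinear_mapsI)
  show "(\<lambda>a'. act J a' x) \<in> linear_maps K A' I" if x: "x \<in> carrier I" for x
  proof (rule induced_linear_param[OF _ _ _ _ x])
    show "(\<lambda>a'. act J a' (e b m)) \<in> linear_maps K A' I" if "b \<in> carrier A'" "m \<in> carrier M" for b m
      by (rule linear_maps_cong[of "\<lambda>a'. e (twist A' a' \<otimes>\<^bsub>A'\<^esub> b) (twist M m)"])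
         (simp_all add: act_J_tens that)
  qed (simp_all add: act_J_linear)
qed (rule act_J_linear)

lemma coact_J_linear: "coact J \<in> linear_maps K I IC"
  and coact_J_tens: "b \<in> carrier A' \<Longrightarrow> m \<in> carrier M \<Longrightarrow> coact J (e b m) = coa b m"
  unfolding coact_J
  by (rule induced_lift_linear induced_lift_tens; simp add: coa_balanced)+

lemmas J_lins [simp] = twist_J_linear coact_J_linear twist_J_linear[THEN linear_maps_closed]
  coact_J_linear[THEN linear_maps_closed] twist_J_linear[THEN lin_comp] coact_J_linear[THEN lin_comp]
  act_J_bilinear act_J_bilinear[THEN bilinear_maps_closed] act_J_bilinear[THEN bilin_left]
  act_J_bilinear[THEN bilin_right]

text \<open>
  The inverse is induced by the inverse twists of \<open>A'\<close> and \<open>M\<close>; they respect the relation because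
  the twist of \<open>A\<close> is invertible as well.
\<close>

lemma twist_J_bij: "bij_betw (twist J) (carrier I) (carrier I)"
proof -
  let ?u = "X.T.A.untwist" and ?v = "M.L.M.untwist" and ?w = "X.S.A.untwist"
  have [simp]: "?u \<in> linear_maps K A' A'" "?v \<in> linear_maps K M M" "?w \<in> linear_maps K A A"
    by (fact X.T.A.untwist_linear M.L.M.untwist_linear X.S.A.untwist_linear)+
  note [simp] = this[THEN linear_maps_closed] this[THEN lin_comp]
    X.T.A.twist_untwist M.L.M.twist_untwist X.S.A.twist_untwist
    X.T.A.untwist_twist M.L.M.untwist_twist X.S.A.untwist_twist
  have bal: "e (?u (b \<otimes>\<^bsub>A'\<^esub> \<beta> a)) m = e b (?v (act M a m))"
    if "b \<in> carrier A'" "a \<in> carrier A" "m \<in> carrier M" for a b m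
  proof -
    have 1: "?u (b \<otimes>\<^bsub>A'\<^esub> \<beta> a) = ?u b \<otimes>\<^bsub>A'\<^esub> \<beta> (?w a)"
      by (rule X.T.A.untwist_eqI) (use that in \<open>simp_all add: X.T.A.twist_mult \<beta>_twist[symmetric]\<close>)
    have 2: "?v (act M a m) = act M (?w a) (?v m)"
      by (rule M.L.M.untwist_eqI) (use that in \<open>simp_all add: M.L.twist_act\<close>)
    show ?thesis using that e_balanced[of "?u b" "?w a" "?v m"] by (simp add: 1 2)
  qed
  let ?i = "induced_lift K A A' \<beta> M I (\<lambda>b m. e (?u b) (?v m))"
  have i: "?i \<in> linear_maps K I I" by (rule induced_lift_linear) (simp_all add: bal)
  have it: "?i (e b m) = e (?u b) (?v m)" if "b \<in> carrier A'" "m \<in> carrier M" for b m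
    by (rule induced_lift_tens) (use that in \<open>simp_all add: bal\<close>)
  have "?i (twist J x) = x" "twist J (?i x) = x" if "x \<in> carrier I" for x
    by (rule induced_ext[where T = I, OF _ lin_id _ that]; simp add: i[THEN lin_comp] twist_J_tens it i)+
  then show ?thesis
    by (intro bij_betw_byWitness[where f' = ?i]) (auto simp: linear_maps_closed[OF i])
qed

lemma J_hom_module: "hom_module K J"
  using X.T.A.hom_algebra_axioms twist_J_bij
  by (simp add: hom_algebra_def hom_module_def hom_module_axioms_def)

lemma J_left_hom_module: "left_hom_module K A' J (act J)"
proof (intro left_hom_module.intro left_hom_module_axioms.intro)
  show "hom_algebra K A'" by (rule X.T.A.hom_algebra_axioms)
  show "hom_module K J" by (rule J_hom_module)
  show "act J \<in> bilinear_maps K A' J J" by simp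
  have 1: "act J \<one>\<^bsub>A'\<^esub> x = twist J x" if "x \<in> carrier I" for x
    by (rule induced_ext[where T = I, OF _ _ _ that])
       (simp_all add: act_J_linear X.T.A.one_closed act_J_tens twist_J_tens X.T.A.twist_one X.T.A.hom_l_one)
  then show "act J \<one>\<^bsub>A'\<^esub> x = twist J x" if "x \<in> carrier J" for x using that by simp
  fix a b x assume ab: "a \<in> carrier A'" "b \<in> carrier A'" and "x \<in> carrier J"
  then have x: "x \<in> carrier I" by simp
  show "twist J (act J a x) = act J (twist A' a) (twist J x)"
    by (rule induced_ext[where T = I, OF _ _ _ x]) (use ab in \<open>simp_all add: act_J_tens twist_J_tens X.T.A.twist_mult\<close>)
  show "act J (twist A' a) (act J b x) = act J (a \<otimes>\<^bsub>A'\<^esub> b) (twist J x)"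
    by (rule induced_ext[where T = I, OF _ _ _ x])
       (use ab in \<open>simp_all add: act_J_tens twist_J_tens X.T.A.twist_mult X.T.A.hom_assoc\<close>)
qed

lemma J_twist_coact:
  assumes x: "x \<in> carrier I"
  shows "tensor_map K I C' I C' (twist J) (twist C') (coact J x) = coact J (twist J x)"
proof (rule induced_ext[where T = IC, OF _ _ _ x])
  have l: "tensor_map K I C' I C' (twist J) (twist C') \<in> linear_maps K IC IC"
    by (rule tensor_map_linear) simp_all
  show "(\<lambda>x. tensor_map K I C' I C' (twist J) (twist C') (coact J x)) \<in> linear_maps K I IC"
    by (simp add: l[THEN lin_comp])
  show "tensor_map K I C' I C' (twist J) (twist C') (coact J (e b m)) = coact J (twist J (e b m))"
    if "b \<in> carrier A'" "m \<in> carrier M" for b m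
    using that
    by (simp add: coact_J_tens twist_J_tens linear_coa[OF _ l] tensor_map_tens coa_eq[of "twist A' b"]
        X.T.A.lift_coact_twist M.R.lift_coact_twist \<kappa>_twist cong: tensor_lift_sweedler_cong)
qed simp

text \<open>
  The counit of \<open>\<kappa>(b\<^sub>1, m\<^sub>1)\<close> splits as a product of scalars, one of which completes \<open>b\<^sub>0\<close> and the other
  \<open>m\<^sub>0\<close> to a counit axiom.
\<close>

lemma J_counit_coact:
  assumes x: "x \<in> carrier I"
  shows "tensor_lift K I C' I (\<lambda>y c. counit C' c \<odot>\<^bsub>I\<^esub> y) (coact J x) = twist J x"
proof (rule induced_ext[where T = I, OF _ _ _ x])
  note gl = X.T.C.counit_linear X.T.H.counit_linear X.S.C.counit_linear
  note sb = smult_bilinear[OF induced_space_module] smult_bilinear[OF datum_modules(4)] smult_bilinear[OF datum_modules(6)]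
  note [simp] = gl gl[THEN linear_maps_closed] gl[THEN lin_comp] sb sb[THEN bilinear_maps_closed]
    sb[THEN bilin_left] sb[THEN bilin_right]
  have carr: "carrier (ground_hom_algebra K) = carrier K" by (simp add: ground_hom_algebra_def)
  let ?g = "tensor_lift K I C' I (\<lambda>y c. counit C' c \<odot>\<^bsub>I\<^esub> y)"
  have b: "(\<lambda>y c. counit C' c \<odot>\<^bsub>I\<^esub> y) \<in> bilinear_maps K I C' I" by simp
  have g: "?g \<in> linear_maps K IC I" by (rule tensor_lift_linear) simp_all
  show "(\<lambda>x. ?g (coact J x)) \<in> linear_maps K I I" by (simp add: g[THEN lin_comp])
  fix b m assume bm: "b \<in> carrier A'" "m \<in> carrier M"
  interpret Im: module K I by simp
  have ee: "(counit H' h \<otimes>\<^bsub>K\<^esub> counit C c) \<odot>\<^bsub>I\<^esub> e b0 m0 = e (counit H' h \<odot>\<^bsub>A'\<^esub> b0) (counit C c \<odot>\<^bsub>M\<^esub> m0)"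
    if "h \<in> carrier H'" "c \<in> carrier C" "b0 \<in> carrier A'" "m0 \<in> carrier M" for h c b0 m0
  proof -
    have "counit H' h \<in> carrier K" "counit C c \<in> carrier K"
      using that linear_maps_closed[OF X.T.H.counit_linear] linear_maps_closed[OF X.S.C.counit_linear] by (simp_all add: carr)
    then show ?thesis
      using that module.smult_closed[OF datum_modules(4)]
        linear_maps_smult[OF bilinear_maps_left[OF e_bilinear, of "counit C c \<odot>\<^bsub>M\<^esub> m0"], of "counit H' h" b0]
        linear_maps_smult[OF bilinear_maps_right[OF e_bilinear, of b0], of "counit C c" m0]
      by (simp add: Im.smult_assoc1)
  qed
  have "?g (coact J (e b m)) = tensor_lift K A' H' I (\<lambda>b0 b1. tensor_lift K M C I
      (\<lambda>m0 m1. e (counit H' b1 \<odot>\<^bsub>A'\<^esub> b0) (counit C m1 \<odot>\<^bsub>M\<^esub> m0)) (coact M m)) (alg_coact A' b)"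
    using bm by (simp add: coact_J_tens linear_coa[OF _ g] tensor_lift_tens b \<kappa>_counit ee cong: tensor_lift_sweedler_cong)
  also have "\<dots> = tensor_lift K A' H' I (\<lambda>b0 b1. e (counit H' b1 \<odot>\<^bsub>A'\<^esub> b0) (twist M m)) (alg_coact A' b)"
  proof (rule tensor_lift_arg_cong)
    fix b0 b1 assume bb: "b0 \<in> carrier A'" "b1 \<in> carrier H'"
    show "tensor_lift K M C I (\<lambda>m0 m1. e (counit H' b1 \<odot>\<^bsub>A'\<^esub> b0) (counit C m1 \<odot>\<^bsub>M\<^esub> m0)) (coact M m) =
        e (counit H' b1 \<odot>\<^bsub>A'\<^esub> b0) (twist M m)"
      unfolding M.R.counit_coact[OF bm(2), symmetric]
      by (rule linear_tensor_lift[symmetric]) (use bb bm in simp_all)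
  qed
  also have "\<dots> = e (twist A' b) (twist M m)"
    unfolding X.T.A.counit_coact[OF bm(1), symmetric]
    by (rule linear_tensor_lift[where g = "\<lambda>x. e x (twist M m)", symmetric]) (use bm in simp_all)
  finally show "?g (coact J (e b m)) = twist J (e b m)" using bm by (simp add: twist_J_tens)
qed simp

text \<open>
  In six variables, the expression \<open>e(b\<^sub>0, m\<^sub>0) \<otimes> (\<kappa>(b\<^sub>1, m\<^sub>1) \<otimes> \<kappa>(b\<^sub>2, m\<^sub>2))\<close> is multilinear. On the left
  the sums over the second coactions of \<open>b\<^sub>0\<close> and \<open>m\<^sub>0\<close> are intertwined; once the sums belonging to
  \<open>b\<close> have been moved outside those belonging to \<open>m\<close>, coassociativity applies first to \<open>M\<close> and then
  to \<open>A'\<close>, and \<open>\<kappa>_comult\<close> collects the result.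
\<close>

lemma J_coact_coact:
  assumes x: "x \<in> carrier I"
  shows "tensor_assoc K I C' C' (tensor_map K I C' IC C' (coact J) (twist C') (coact J x)) =
    tensor_map K I C' I (tensor_space K C' C') (twist J) (comult C') (coact J x)"
proof (rule induced_ext[where T = "tensor_space K I (tensor_space K C' C')", OF _ _ _ x])
  let ?CC = "tensor_space K C' C'"
  let ?T = "tensor_space K I ?CC"
  have l1: "tensor_map K I C' IC C' (coact J) (twist C') \<in> linear_maps K IC (tensor_space K IC C')"
    by (rule tensor_map_linear) simp_all
  have l2: "tensor_map K I C' I ?CC (twist J) (comult C') \<in> linear_maps K IC ?T"
    by (rule tensor_map_linear) simp_all
  have l3: "tensor_assoc K I C' C' \<in> linear_maps K (tensor_space K IC C') ?T"
    by (rule tensor_assoc_linear) simp_all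
  note L = linear_maps_comp[OF l1 l3]
  show "(\<lambda>x. tensor_assoc K I C' C' (tensor_map K I C' IC C' (coact J) (twist C') (coact J x))) \<in> linear_maps K I ?T"
    by (rule linear_maps_comp[OF coact_J_linear L])
  show "(\<lambda>x. tensor_map K I C' I ?CC (twist J) (comult C') (coact J x)) \<in> linear_maps K I ?T"
    by (rule linear_maps_comp[OF coact_J_linear l2])
  fix b m assume b: "b \<in> carrier A'" and m: "m \<in> carrier M"
  let ?t = "\<lambda>b0 b1 b2 m0 m1 m2. tens K I ?CC (e b0 m0) (tens K C' C' (\<kappa> b1 m1) (\<kappa> b2 m2))"
  let ?LA = "\<lambda>f b. tensor_lift K A' H' ?T f (alg_coact A' b)" and ?LM = "\<lambda>f m. tensor_lift K M C ?T f (coact M m)"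
    and ?LH = "\<lambda>f h. tensor_lift K H' H' ?T f (comult H' h)" and ?LC = "\<lambda>f c. tensor_lift K C C ?T f (comult C c)"
  have g: "tensor_lift K I C' ?T (\<lambda>u v. tens K I ?CC u (tens K C' C' v c)) \<in> linear_maps K IC ?T"
    if "c \<in> carrier C'" for c by (rule tensor_lift_linear) (use that in simp_all)
  \<comment> \<open>The twist of \<open>C'\<close> passes into both arguments of \<open>\<kappa>\<close>, where coassociativity needs it.\<close>
  have inner: "tensor_assoc K I C' C' (tensor_map K I C' IC C' (coact J) (twist C') (tens K I C' (e b0 m0) (\<kappa> b1 m1))) =
      ?LA (\<lambda>b00 b01. ?LM (\<lambda>m00 m01. ?t b00 b01 (twist H' b1) m00 m01 (twist C m1)) m0) b0"
    if "b0 \<in> carrier A'" "b1 \<in> carrier H'" "m0 \<in> carrier M" "m1 \<in> carrier C" for b0 b1 m0 m1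
    using that by (simp add: tensor_map_tens tensor_assoc_tens coact_J_tens linear_coa[OF _ g] tensor_lift_tens
      \<kappa>_twist cong: tensor_lift_sweedler_cong)
  have "tensor_assoc K I C' C' (tensor_map K I C' IC C' (coact J) (twist C') (coact J (e b m))) =
      ?LA (\<lambda>b0 b1. ?LM (\<lambda>m0 m1. ?LA (\<lambda>b00 b01. ?LM (\<lambda>m00 m01.
        ?t b00 b01 (twist H' b1) m00 m01 (twist C m1)) m0) b0) m) b"
    using b m by (simp add: coact_J_tens linear_coa[OF _ L] inner cong: tensor_lift_sweedler_cong)
  also have "\<dots> = ?LA (\<lambda>b0 b1. ?LA (\<lambda>b00 b01. ?LM (\<lambda>m0 m1. ?LM (\<lambda>m00 m01.
        ?t b00 b01 (twist H' b1) m00 m01 (twist C m1)) m0) m) b0) b"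
    by (rule tensor_lift_arg_cong, rule tensor_lift_swap) (use b m in simp_all)
  also have "\<dots> = ?LA (\<lambda>b0 b1. ?LA (\<lambda>b00 b01. ?LM (\<lambda>m0 m1. ?LC (\<lambda>c1 c2.
        ?t b00 b01 (twist H' b1) (twist M m0) c1 c2) m1) m) b0) b"
    by (intro tensor_lift_arg_cong M.R.coassoc_sweedler) (use b m in simp_all)
  also have "\<dots> = ?LA (\<lambda>b0 b1. ?LH (\<lambda>h1 h2. ?LM (\<lambda>m0 m1. ?LC (\<lambda>c1 c2.
        ?t (twist A' b0) h1 h2 (twist M m0) c1 c2) m1) m) b1) b"
    by (rule X.T.A.coassoc_sweedler) (use b m in simp_all)
  also have "\<dots> = ?LA (\<lambda>b0 b1. ?LM (\<lambda>m0 m1. ?LH (\<lambda>h1 h2. ?LC (\<lambda>c1 c2.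
        ?t (twist A' b0) h1 h2 (twist M m0) c1 c2) m1) b1) m) b"
    by (rule tensor_lift_arg_cong, rule tensor_lift_swap) (use b m in simp_all)
  also have "\<dots> = tensor_map K I C' I ?CC (twist J) (comult C') (coact J (e b m))"
    using b m by (simp add: coact_J_tens linear_coa[OF _ l2] tensor_map_tens twist_J_tens \<kappa>_comult
      linear_tensor_lift[where T = ?CC and U = ?T] cong: tensor_lift_sweedler_cong)
  finally show "tensor_assoc K I C' C' (tensor_map K I C' IC C' (coact J) (twist C') (coact J (e b m))) = \<dots>" .
qed

text \<open>
  Both sides are sums of \<open>e(\<alpha>(a\<^sub>0) b\<^sub>0, \<alpha>(m\<^sub>0)) \<otimes> \<kappa>(\<alpha>(a\<^sub>1) b\<^sub>1, \<alpha>(m\<^sub>1))\<close>, by \<open>\<kappa>_mult\<close> on the right.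
\<close>

lemma J_coact_act:
  assumes a: "a \<in> carrier A'" and x: "x \<in> carrier I"
  shows "coact J (act J a x) = tensor_bimap K A' H' I C' I C' (act J) (coalg_act C') (alg_coact A' a) (coact J x)"
proof (rule induced_ext[where T = IC, OF _ _ _ x])
  let ?g = "\<lambda>a0 a1. tensor_map K I C' I C' (act J a0) (coalg_act C' a1)"
  have g: "?g a0 a1 \<in> linear_maps K IC IC" if "a0 \<in> carrier A'" "a1 \<in> carrier H'" for a0 a1
    by (rule tensor_map_linear) (use that in simp_all)
  have gb: "(\<lambda>a0 a1. ?g a0 a1 t) \<in> bilinear_maps K A' H' IC" if "t \<in> carrier IC" for t
    by (rule bilinear_mapsI; (rule tensor_map_param_left | rule tensor_map_param_right))
       (use that in simp_all)
  have B: "tensor_bimap K A' H' I C' I C' (act J) (coalg_act C') (alg_coact A' a) t =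
      tensor_lift K A' H' IC (\<lambda>a0 a1. ?g a0 a1 t) (alg_coact A' a)" for t
    by (simp add: tensor_bimap_def)
  show "(\<lambda>x. tensor_bimap K A' H' I C' I C' (act J) (coalg_act C') (alg_coact A' a) (coact J x))
      \<in> linear_maps K I IC"
    unfolding B by (rule tensor_lift_param) (use a gb g in \<open>simp_all add: g[THEN lin_comp]\<close>)
  fix b m assume b: "b \<in> carrier A'" and m: "m \<in> carrier M"
  show "coact J (act J a (e b m)) =
      tensor_bimap K A' H' I C' I C' (act J) (coalg_act C') (alg_coact A' a) (coact J (e b m))"
    unfolding B using a b m
    by (simp add: act_J_tens coact_J_tens linear_coa[OF _ g] tensor_map_tens coa_eq[of "twist A' a \<otimes>\<^bsub>A'\<^esub> b"]
      X.T.A.lift_alg_coact_mult[OF X.T.H.hom_algebra_axioms] X.T.A.lift_coact_twist M.R.lift_coact_twist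
      \<kappa>_mult cong: tensor_lift_sweedler_cong)
qed (use a in simp)

theorem induced_module_is_doi_hopf_module: "doi_hopf_module K H' A' C' J"
proof (intro doi_hopf_module.intro doi_hopf_module_axioms.intro right_hom_comodule.intro
    right_hom_comodule_axioms.intro)
  show "doi_hopf_datum K H' A' C'" by (rule X.T.doi_hopf_datum_axioms)
  show "left_hom_module K A' J (act J)" by (rule J_left_hom_module)
  show "hom_coalgebra K C'" by (rule X.T.C.hom_coalgebra_axioms)
  show "hom_module K J" by (rule J_hom_module)
qed (simp_all add: J_twist_coact J_counit_coact J_coact_coact J_coact_act)

end

section \<open>The category of Doi-Hopf modules\<close>

lemma doi_hopf_mapsI:
  assumes "f \<in> linear_maps K M N" "f \<in> extensional (carrier M)"
    and "\<And>m. m \<in> carrier M \<Longrightarrow> f (twist M m) = twist N (f m)"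
    and "\<And>a m. a \<in> carrier A \<Longrightarrow> m \<in> carrier M \<Longrightarrow> f (act M a m) = act N a (f m)"
    and "\<And>m. m \<in> carrier M \<Longrightarrow> coact N (f m) = tensor_map K M C N C f (\<lambda>c. c) (coact M m)"
  shows "f \<in> doi_hopf_maps K A C M N"
  using assms by (simp add: doi_hopf_maps_def)

lemma doi_hopf_mapsD:
  assumes "f \<in> doi_hopf_maps K A C M N"
  shows "f \<in> linear_maps K M N" "f \<in> extensional (carrier M)"
    and "m \<in> carrier M \<Longrightarrow> f (twist M m) = twist N (f m)"
    and "a \<in> carrier A \<Longrightarrow> m \<in> carrier M \<Longrightarrow> f (act M a m) = act N a (f m)"
    and "m \<in> carrier M \<Longrightarrow> coact N (f m) = tensor_map K M C N C f (\<lambda>c. c) (coact M m)"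
  using assms by (auto simp: doi_hopf_maps_def)

context doi_hopf_module
begin

lemma modules: "module K M" "module K C"
  by (fact L.M.module_axioms D.C.module_axioms)+

lemma structure_closed: "m \<in> carrier M \<Longrightarrow> twist M m \<in> carrier M"
    "a \<in> carrier A \<Longrightarrow> m \<in> carrier M \<Longrightarrow> act M a m \<in> carrier M"
    "m \<in> carrier M \<Longrightarrow> coact M m \<in> carrier (tensor_space K M C)"
  by (fact linear_maps_closed[OF L.M.twist_linear] bilinear_maps_closed[OF L.act_bilinear]
      linear_maps_closed[OF R.coact_linear])+

end

lemma identity_map:
  assumes "doi_hopf_module K H A C M"
  shows "(\<lambda>m\<in>carrier M. m) \<in> doi_hopf_maps K A C M M"
proof -
  interpret doi_hopf_module K H A C M by fact
  show ?thesis
  proof (rule doi_hopf_mapsI)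
    show "(\<lambda>m\<in>carrier M. m) \<in> linear_maps K M M"
      by (rule linear_maps_cong[OF lin_id modules(1)]) simp
    fix m assume m: "m \<in> carrier M"
    have "tensor_map K M C M C (\<lambda>m\<in>carrier M. m) (\<lambda>c. c) = tensor_map K M C M C (\<lambda>m. m) (\<lambda>c. c)"
      by (rule tensor_map_cong) simp_all
    then show "coact M ((\<lambda>m\<in>carrier M. m) m) = tensor_map K M C M C (\<lambda>m\<in>carrier M. m) (\<lambda>c. c) (coact M m)"
      using m by (simp add: tensor_map_def tensor_lift_id[OF modules] structure_closed)
  qed (simp_all add: structure_closed)
qed

lemma compose_map:
  assumes M: "doi_hopf_module K H A C M" and N: "doi_hopf_module K H A C N" and P: "doi_hopf_module K H A C P"
    and f: "f \<in> doi_hopf_maps K A C M N" and g: "g \<in> doi_hopf_maps K A C N P"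
  shows "compose (carrier M) g f \<in> doi_hopf_maps K A C M P"
proof (rule doi_hopf_mapsI)
  interpret M: doi_hopf_module K H A C M by (rule M)
  interpret N: doi_hopf_module K H A C N by (rule N)
  interpret P: doi_hopf_module K H A C P by (rule P)
  note fD = doi_hopf_mapsD[OF f] and gD = doi_hopf_mapsD[OF g]
  note cl = linear_maps_closed[OF fD(1)]
  have c: "compose (carrier M) g f m = g (f m)" if "m \<in> carrier M" for m
    using that by (simp add: compose_def)
  show "compose (carrier M) g f \<in> linear_maps K M P"
    by (rule linear_maps_cong[OF linear_maps_comp[OF fD(1) gD(1)] M.modules(1)]) (rule c)
  show "compose (carrier M) g f \<in> extensional (carrier M)" by (simp add: compose_def)
  fix m assume m: "m \<in> carrier M"
  show "compose (carrier M) g f (twist M m) = twist P (compose (carrier M) g f m)"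
    using m by (simp add: c M.structure_closed cl fD(3) gD(3))
  show "compose (carrier M) g f (act M a m) = act P a (compose (carrier M) g f m)" if "a \<in> carrier A" for a
    using m that by (simp add: c M.structure_closed cl fD(4) gD(4))
  have "coact P (compose (carrier M) g f m) = tensor_map K N C P C g (\<lambda>c. c) (tensor_map K M C N C f (\<lambda>c. c) (coact M m))"
    using m by (simp add: c cl fD(5) gD(5))
  also have "\<dots> = tensor_map K M C P C (\<lambda>m. g (f m)) (\<lambda>c. c) (coact M m)"
    unfolding tensor_map_def[of K N C P C] tensor_map_def[of K M C P C]
    by (rule tensor_lift_tensor_map)
       (simp_all add: M.modules N.modules P.modules tensor_space_module tens_maps_bilinear
          fD(1) gD(1) lin_id M.structure_closed m)
  also have "\<dots> = tensor_map K M C P C (compose (carrier M) g f) (\<lambda>c. c) (coact M m)"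
    by (rule arg_cong[where f = "\<lambda>f. f (coact M m)"], rule tensor_map_cong) (simp_all add: c)
  finally show "coact P (compose (carrier M) g f m) = \<dots>" .
qed

lemma doi_hopf_category_is_category: "category (doi_hopf_category K H A C)"
proof
  fix M N P Q f g h
  assume ob: "M \<in> Ob (doi_hopf_category K H A C)" "N \<in> Ob (doi_hopf_category K H A C)"
    "P \<in> Ob (doi_hopf_category K H A C)"
    and f: "f \<in> Hom (doi_hopf_category K H A C) M N"
    and g: "g \<in> Hom (doi_hopf_category K H A C) N P"
  then show "Comp (doi_hopf_category K H A C) M N P g f \<in> Hom (doi_hopf_category K H A C) M P"
    by (auto simp: doi_hopf_category_def intro: compose_map)
  have "f m \<in> carrier N" if "m \<in> carrier M" for m
    using f that by (auto simp: doi_hopf_category_def dest: doi_hopf_mapsD(1) linear_maps_closed)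
  then show "Comp (doi_hopf_category K H A C) M P Q h (Comp (doi_hopf_category K H A C) M N P g f) =
      Comp (doi_hopf_category K H A C) M N Q (Comp (doi_hopf_category K H A C) N P Q h g) f"
    by (auto simp: doi_hopf_category_def compose_def fun_eq_iff)
next
  fix M N f
  assume f: "f \<in> Hom (doi_hopf_category K H A C) M N"
  then have f': "f \<in> linear_maps K M N" "f \<in> extensional (carrier M)"
    by (auto simp: doi_hopf_category_def dest: doi_hopf_mapsD)
  then show "Comp (doi_hopf_category K H A C) M N N (Id (doi_hopf_category K H A C) N) f = f"
    "Comp (doi_hopf_category K H A C) M M N f (Id (doi_hopf_category K H A C) M) = f"
    by (auto simp: doi_hopf_category_def compose_def fun_eq_iff extensional_def dest: linear_maps_closed)
qed (auto simp: doi_hopf_category_def intro: identity_map)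

section \<open>The induction functor\<close>

definition induced_map ::
    "('k, 'r) ring_scheme \<Rightarrow> ('k, 'a, 's) hom_module_scheme \<Rightarrow> ('k, 'b, 't) hom_module_scheme \<Rightarrow>
     ('a \<Rightarrow> 'b) \<Rightarrow> ('k, 'm, 'a, 'c) doi_hopf_module \<Rightarrow> ('k, 'n, 'a, 'c) doi_hopf_module \<Rightarrow>
     ('m \<Rightarrow> 'n) \<Rightarrow> ('k, 'b, 'm) tensor set \<Rightarrow> ('k, 'b, 'n) tensor set"
  where "induced_map K A A' \<beta> M N f = induced_lift K A A' \<beta> M (induced_space K A A' \<beta> N)
    (\<lambda>b m. induced_tens K A A' \<beta> N b (f m))"

locale doi_hopf_induction_map =
  P: doi_hopf_induction K H A C H' A' C' \<theta> \<beta> \<gamma> M + Q: doi_hopf_induction K H A C H' A' C' \<theta> \<beta> \<gamma> N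
  for K :: "('k, 'r) ring_scheme"
    and H :: "('k, 'h, 's) hom_hopf_algebra_scheme"
    and A :: "('k, 'a, 'h, 't) comodule_algebra_scheme"
    and C :: "('k, 'c, 'h, 'u) module_coalgebra_scheme"
    and H' :: "('k, 'h', 's') hom_hopf_algebra_scheme"
    and A' :: "('k, 'a', 'h', 't') comodule_algebra_scheme"
    and C' :: "('k, 'c', 'h', 'u') module_coalgebra_scheme"
    and \<theta> :: "'h \<Rightarrow> 'h'" and \<beta> :: "'a \<Rightarrow> 'a'" and \<gamma> :: "'c \<Rightarrow> 'c'"
    and M :: "('k, 'm, 'a, 'c) doi_hopf_module" and N :: "('k, 'n, 'a, 'c) doi_hopf_module" +
  fixes f :: "'m \<Rightarrow> 'n"
  assumes f: "f \<in> doi_hopf_maps K A C M N"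
begin

lemmas fD = doi_hopf_mapsD[OF f]

lemmas [simp] = fD(1) fD(1)[THEN linear_maps_closed] fD(1)[THEN lin_comp]

abbreviation "F \<equiv> induced_map K A A' \<beta> M N f"

lemma balanced: "b \<in> carrier A' \<Longrightarrow> a \<in> carrier A \<Longrightarrow> m \<in> carrier M \<Longrightarrow>
    Q.e (b \<otimes>\<^bsub>A'\<^esub> \<beta> a) (f (twist M m)) = Q.e (twist A' b) (f (act M a m))"
  by (simp add: fD Q.e_balanced)

lemma F_linear: "F \<in> linear_maps K P.I Q.I"
  and F_tens: "b \<in> carrier A' \<Longrightarrow> m \<in> carrier M \<Longrightarrow> F (P.e b m) = Q.e b (f m)"
  and F_extensional: "F \<in> extensional (carrier P.I)"
  unfolding induced_map_def
  by (rule P.induced_lift_linear P.induced_lift_tens P.induced_lift_extensional; simp add: balanced)+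

lemmas [simp] = F_linear F_linear[THEN linear_maps_closed] F_linear[THEN lin_comp]

text \<open>
  Colinearity of \<open>id \<otimes> f\<close> on \<open>b \<otimes> m\<close> is colinearity of \<open>f\<close> inside the Sweedler sum over the coaction
  of \<open>b\<close>.
\<close>

lemma F_map: "F \<in> doi_hopf_maps K A' C' P.J Q.J"
proof (rule doi_hopf_mapsI)
  fix x assume "x \<in> carrier P.J"
  then have x: "x \<in> carrier P.I" by simp
  show "F (twist P.J x) = twist Q.J (F x)"
    by (rule P.induced_ext[where T = Q.I, OF _ _ _ x]) (simp_all add: P.twist_J_tens Q.twist_J_tens F_tens fD)
  show "F (act P.J a x) = act Q.J a (F x)" if "a \<in> carrier A'" for a
    by (rule P.induced_ext[where T = Q.I, OF _ _ _ x])
       (use that in \<open>simp_all add: P.act_J_tens Q.act_J_tens F_tens fD\<close>)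
  have l: "tensor_map K P.I C' Q.I C' F (\<lambda>c. c) \<in> linear_maps K P.IC Q.IC"
    by (rule tensor_map_linear) simp_all
  have "coact Q.J (F x) = tensor_map K P.I C' Q.I C' F (\<lambda>c. c) (coact P.J x)"
  proof (rule P.induced_ext[where T = Q.IC, OF _ _ _ x])
    show "(\<lambda>x. tensor_map K P.I C' Q.I C' F (\<lambda>c. c) (coact P.J x)) \<in> linear_maps K P.I Q.IC"
      by (simp add: l[THEN lin_comp])
    show "coact Q.J (F (P.e b m)) = tensor_map K P.I C' Q.I C' F (\<lambda>c. c) (coact P.J (P.e b m))"
      if "b \<in> carrier A'" "m \<in> carrier M" for b m
      using that
      by (simp add: P.coact_J_tens Q.coact_J_tens F_tens P.linear_coa[OF _ l] Q.coa_eq[of b] fD(5)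
          tensor_lift_tensor_map tensor_map_tens cong: tensor_lift_sweedler_cong)
  qed simp
  then show "coact Q.J (F x) = tensor_map K P.J C' Q.J C' F (\<lambda>c. c) (coact P.J x)" by simp
qed (simp_all add: F_extensional)

end

text \<open>
  Functoriality of the induction is an equality of extensional functions, hence it too is a matter
  of generators.
\<close>

lemma (in doi_hopf_induction) induced_extensionalityI:
  assumes "f \<in> linear_maps K I T" "g \<in> linear_maps K I T"
    "f \<in> extensional (carrier I)" "g \<in> extensional (carrier I)"
    "\<And>b m. b \<in> carrier A' \<Longrightarrow> m \<in> carrier M \<Longrightarrow> f (e b m) = g (e b m)"
  shows "f = g"
  by (rule extensionalityI[OF assms(3,4)]) (rule induced_ext[OF assms(1,2,5)])

theorem proposition2p6:
  fixes K :: "('k, 'r) ring_scheme"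
    and H :: "('k, 'h, 's) hom_hopf_algebra_scheme"
    and A :: "('k, 'a, 'h, 't) comodule_algebra_scheme"
    and C :: "('k, 'c, 'h, 'u) module_coalgebra_scheme"
    and H' :: "('k, 'h', 's') hom_hopf_algebra_scheme"
    and A' :: "('k, 'a', 'h', 't') comodule_algebra_scheme"
    and C' :: "('k, 'c', 'h', 'u') module_coalgebra_scheme"
    and \<theta> :: "'h \<Rightarrow> 'h'" and \<beta> :: "'a \<Rightarrow> 'a'" and \<gamma> :: "'c \<Rightarrow> 'c'"
  assumes "doi_hopf_datum_morphism K H A C H' A' C' \<theta> \<beta> \<gamma>"
  shows "\<exists>(F :: ('k, 'm, 'a, 'c) doi_hopf_module \<Rightarrow>
              ('k, ('k, 'a', 'm) tensor set, 'a', 'c') doi_hopf_module) Fm.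
    cat_functor (doi_hopf_category K H A C) (doi_hopf_category K H' A' C') F Fm \<and>
    (\<forall>M \<in> Ob (doi_hopf_category K H A C).
      module.truncate (F M) = induced_space K A A' \<beta> M \<and>
      (\<forall>b' \<in> carrier A'. \<forall>m \<in> carrier M.
        twist (F M) (induced_tens K A A' \<beta> M b' m) =
          induced_tens K A A' \<beta> M (twist A' b') (twist M m)) \<and>
      (\<forall>a' \<in> carrier A'. \<forall>b' \<in> carrier A'. \<forall>m \<in> carrier M.
        act (F M) a' (induced_tens K A A' \<beta> M b' m) =
          induced_tens K A A' \<beta> M (twist A' a' \<otimes>\<^bsub>A'\<^esub> b') (twist M m)) \<and>
      (\<forall>b' \<in> carrier A'. \<forall>m \<in> carrier M.
        coact (F M) (induced_tens K A A' \<beta> M b' m) =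
          tensor_lift K A' H' (tensor_space K (F M) C')
            (\<lambda>b0 b1. tensor_lift K M C (tensor_space K (F M) C')
              (\<lambda>m0 m1. tens K (F M) C' (induced_tens K A A' \<beta> M b0 m0)
                ((inv_into (carrier C') (twist C') ^^ 2) (coalg_act C' b1 (\<gamma> m1))))
              (coact M m))
            (alg_coact A' b'))) \<and>
    (\<forall>M \<in> Ob (doi_hopf_category K H A C). \<forall>N \<in> Ob (doi_hopf_category K H A C).
      \<forall>f \<in> Hom (doi_hopf_category K H A C) M N. \<forall>b' \<in> carrier A'. \<forall>m \<in> carrier M.
        Fm M N f (induced_tens K A A' \<beta> M b' m) = induced_tens K A A' \<beta> N b' (f m))"
proof -
  let ?C = "doi_hopf_category K H A C :: (('k, 'm, 'a, 'c) doi_hopf_module, 'm \<Rightarrow> 'm) category"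
  let ?D = "doi_hopf_category K H' A' C' ::
    (('k, ('k, 'a', 'm) tensor set, 'a', 'c') doi_hopf_module,
      ('k, 'a', 'm) tensor set \<Rightarrow> ('k, 'a', 'm) tensor set) category"
  let ?F = "induced_module K A H' A' C C' \<beta> \<gamma> ::
    ('k, 'm, 'a, 'c) doi_hopf_module \<Rightarrow> ('k, ('k, 'a', 'm) tensor set, 'a', 'c') doi_hopf_module"
  let ?Fm = "induced_map K A A' \<beta> :: ('k, 'm, 'a, 'c) doi_hopf_module \<Rightarrow> ('k, 'm, 'a, 'c) doi_hopf_module \<Rightarrow>
    ('m \<Rightarrow> 'm) \<Rightarrow> ('k, 'a', 'm) tensor set \<Rightarrow> ('k, 'a', 'm) tensor set"
  have ob: "doi_hopf_induction K H A C H' A' C' \<theta> \<beta> \<gamma> M" if "M \<in> Ob ?C" for M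
    using assms that by (simp add: doi_hopf_induction_def doi_hopf_category_def)
  have hom: "doi_hopf_induction_map K H A C H' A' C' \<theta> \<beta> \<gamma> M N f"
    if "M \<in> Ob ?C" "N \<in> Ob ?C" "f \<in> Hom ?C M N" for M N f
    using ob that by (simp add: doi_hopf_induction_map_def doi_hopf_induction_map_axioms_def doi_hopf_category_def)
  have "cat_functor ?C ?D ?F ?Fm"
  proof (intro cat_functor.intro cat_functor_axioms.intro doi_hopf_category_is_category)
    fix M assume M: "M \<in> Ob ?C"
    interpret M: doi_hopf_induction K H A C H' A' C' \<theta> \<beta> \<gamma> M by (rule ob[OF M])
    show "?F M \<in> Ob ?D" using M.induced_module_is_doi_hopf_module by (simp add: doi_hopf_category_def)
    have "(\<lambda>m\<in>carrier M. m) \<in> Hom ?C M M"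
      using identity_map[OF M.M.doi_hopf_module_axioms] by (simp add: doi_hopf_category_def)
    then interpret im: doi_hopf_induction_map K H A C H' A' C' \<theta> \<beta> \<gamma> M M "\<lambda>m\<in>carrier M. m"
      using hom[OF M M] by blast
    have "?Fm M M (\<lambda>m\<in>carrier M. m) = (\<lambda>x\<in>carrier M.I. x)"
      by (rule M.induced_extensionalityI[where T = M.I])
         (simp_all add: im.F_extensional im.F_tens linear_maps_cong[OF lin_id M.induced_space_module])
    then show "?Fm M M (Id ?C M) = Id ?D (?F M)" by (simp add: doi_hopf_category_def)
    fix N f assume N: "N \<in> Ob ?C" and f: "f \<in> Hom ?C M N"
    interpret fm: doi_hopf_induction_map K H A C H' A' C' \<theta> \<beta> \<gamma> M N f by (rule hom[OF M N f])
    show "?Fm M N f \<in> Hom ?D (?F M) (?F N)" using fm.F_map by (simp add: doi_hopf_category_def)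
    fix P g assume P: "P \<in> Ob ?C" and g: "g \<in> Hom ?C N P"
    interpret gm: doi_hopf_induction_map K H A C H' A' C' \<theta> \<beta> \<gamma> N P g by (rule hom[OF N P g])
    interpret gfm: doi_hopf_induction_map K H A C H' A' C' \<theta> \<beta> \<gamma> M P "compose (carrier M) g f"
      by (rule hom[OF M P]) (use M N P f g in \<open>auto simp: doi_hopf_category_def intro: compose_map\<close>)
    have "?Fm M P (compose (carrier M) g f) = compose (carrier M.I) (?Fm N P g) (?Fm M N f)"
      by (rule M.induced_extensionalityI[where T = "induced_space K A A' \<beta> P"])
         (simp_all add: gfm.F_extensional gfm.F_tens fm.F_tens gm.F_tens compose_eq compose_extensional
            linear_maps_cong[OF linear_maps_comp[OF fm.F_linear gm.F_linear] M.induced_space_module])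
    then show "?Fm M P (Comp ?C M N P g f) = Comp ?D (?F M) (?F N) (?F P) (?Fm N P g) (?Fm M N f)"
      by (simp add: doi_hopf_category_def)
  qed
  moreover have "module.truncate (?F M) = induced_space K A A' \<beta> M" for M
    by (simp add: induced_module_def Let_def module.truncate_def)
  moreover have "twist (?F M) (induced_tens K A A' \<beta> M b m) = induced_tens K A A' \<beta> M (twist A' b) (twist M m)"
    "a \<in> carrier A' \<Longrightarrow> act (?F M) a (induced_tens K A A' \<beta> M b m) =
      induced_tens K A A' \<beta> M (twist A' a \<otimes>\<^bsub>A'\<^esub> b) (twist M m)"
    "coact (?F M) (induced_tens K A A' \<beta> M b m) =
          tensor_lift K A' H' (tensor_space K (?F M) C')
            (\<lambda>b0 b1. tensor_lift K M C (tensor_space K (?F M) C')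
              (\<lambda>m0 m1. tens K (?F M) C' (induced_tens K A A' \<beta> M b0 m0)
                ((inv_into (carrier C') (twist C') ^^ 2) (coalg_act C' b1 (\<gamma> m1))))
              (coact M m))
            (alg_coact A' b)"
    if "M \<in> Ob ?C" "b \<in> carrier A'" "m \<in> carrier M" for M a b m
  proof -
    interpret M: doi_hopf_induction K H A C H' A' C' \<theta> \<beta> \<gamma> M by (rule ob[OF that(1)])
    show "twist (?F M) (M.e b m) = M.e (twist A' b) (twist M m)"
      "a \<in> carrier A' \<Longrightarrow> act (?F M) a (M.e b m) = M.e (twist A' a \<otimes>\<^bsub>A'\<^esub> b) (twist M m)"
      using that by (simp_all add: M.twist_J_tens M.act_J_tens)
    show "coact (?F M) (M.e b m) =
          tensor_lift K A' H' (tensor_space K (?F M) C')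
            (\<lambda>b0 b1. tensor_lift K M C (tensor_space K (?F M) C')
              (\<lambda>m0 m1. tens K (?F M) C' (M.e b0 m0)
                ((inv_into (carrier C') (twist C') ^^ 2) (coalg_act C' b1 (\<gamma> m1))))
              (coact M m))
            (alg_coact A' b)"
      using M.coact_J_tens[OF that(2,3)] by (simp only: M.coa_eq untwisted_act_def M.J_transfer)
  qed
  moreover have "?Fm M N f (induced_tens K A A' \<beta> M b m) = induced_tens K A A' \<beta> N b (f m)"
    if "M \<in> Ob ?C" "N \<in> Ob ?C" "f \<in> Hom ?C M N" "b \<in> carrier A'" "m \<in> carrier M" for M N f b m
    by (rule doi_hopf_induction_map.F_tens[OF hom[OF that(1-3)] that(4,5)])
  ultimately show ?thesis by (intro exI[of _ ?F] exI[of _ ?Fm]) blast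
qed

end
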